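(* Let $A=(a_{j,q})_{j\in\mathbb{N},q\in\mathbb{N}_0}$ be a K\"othe matrix such that $\lambda^\infty(A)$ is nuclear and $\lambda^\infty(A)\subset c_0$. For $\mathcal{N}\subset\mathbb{N}$ let $e_{\mathcal{N}}$ denote the sequence which equals $1$ on $\mathcal{N}$ and $0$ otherwise. Let $E$ be an infinite-dimensional closed ${}^*$-subalgebra of $\lambda^\infty(A)$. Then there is a family $\{\mathcal{N}_k\}_{k\in\mathbb{N}}$ of finite nonempty pairwise disjoint sets of natural numbers such that (i) $(e_{\mathcal{N}_k})_{k\in\mathbb{N}}$ is a Schauder basis of $E$; (ii) $E\cong\lambda^\infty\left(\max_{j\in\mathcal{N}_k}a_{j,q}\right)$ as Fr\'echet ${}^*$-algebras and the isomorphism is given by $e_{\mathcal{N}_k}\mapsto e_k$ for $k\in\mathbb{N}$. Conversely, if $\{\mathcal{N}_k\}_{k\in\mathbb{N}}$ is a family of finite nonempty pairwise disjoint sets of natural numbers and $F$ is the closed ${}^*$-subalgebra of $\lambda^\infty(A)$ generated by the set $\{e_{\mathcal{N}_k}\}_{k\in\mathbb{N}}$, then (iii) $(e_{\mathcal{N}_k})_{k\in\mathbb{N}}$ is a Schauder basis of $F$; (iv) $F\cong\lambda^\infty(\max_{j\in\mathcal{N}_k}a_{j,q})$ as Fr\'echet ${}^*$-algebras and the isomorphism is given by $e_{\mathcal{N}_k}\mapsto e_k$ for $k\in\mathbb{N}$.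
   Context: $\mathbb{N}=\{1,2,\dots\}$, $\mathbb{N}_0=\mathbb{N}\cup\{0\}$; all spaces are over $\mathbb{C}$. A Fr\'echet ${}^*$-algebra is a Fr\'echet space (complete metrizable locally convex space) that is an algebra with continuous multiplication and continuous involution; an isomorphism of Fr\'echet ${}^*$-algebras is an algebra ${}^*$-isomorphism that is also a homeomorphism. A K\"othe matrix is a matrix $A=(a_{j,q})_{j\in\mathbb{N},q\in\mathbb{N}_0}$ of non-negative numbers such that for each $j$ there is $q$ with $a_{j,q}>0$, and $a_{j,q}\leq a_{j,q+1}$ for all $j,q$. The K\"othe space $$\lambda^\infty(A)=\lambda^\infty(a_{j,q}):=\{\xi=(\xi_j)_{j\in\mathbb{N}}\in\mathbb{C}^{\mathbb{N}}:|\xi|_{\infty,q}:=\sup_{j\in\mathbb{N}}|\xi_j|a_{j,q}<\infty\text{ for all }q\in\mathbb{N}_0\}$$ carries the Fr\'echet topology given by the seminorms $(|\cdot|_{\infty,q})_{q\in\mathbb{N}_0}$. If $\lambda^\infty(A)$ is contained in $\ell_\infty$, it is a Fr\'echet ${}^*$-algebra with pointwise multiplication and pointwise complex conjugation. The notation $\lambda^\infty(\max_{j\in\mathcal{N}_k}a_{j,q})$ means $\lambda^\infty(B)$ with $B=(\max_{j\in\mathcal{N}_k}a_{j,q})_{k\in\mathbb{N},q\in\mathbb{N}_0}$. $c_0$ is the space of complex null sequences, and $e_k$ is the sequence with $k$-th coordinate $1$ and all other coordinates $0$. *)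

theory Defs
  imports "HOL-Analysis.Analysis" "HOL-Library.Function_Algebras"
begin

text \<open>
  Complex sequences form a commutative ring under the pointwise operations of
  \<^theory>\<open>HOL-Library.Function_Algebras\<close>. Index sets are the type \<^typ>\<open>nat\<close>, so
  sequences are numbered from 0 instead of from 1. The product topology that HOL-Analysis puts
  on function types plays no role; all topologies below are explicit.
\<close>

type_synonym cseq = "nat \<Rightarrow> complex"

definition cscale :: "complex \<Rightarrow> cseq \<Rightarrow> cseq"
  where "cscale c x = (\<lambda>j. c * x j)"

definition cconj :: "cseq \<Rightarrow> cseq"
  where "cconj x = (\<lambda>j. cnj (x j))"

global_interpretation cseq: vector_space cscale
  by standard (auto simp: cscale_def fun_eq_iff algebra_simps)

definition infinite_dimensional :: "cseq set \<Rightarrow> bool"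
  where "infinite_dimensional E \<longleftrightarrow> \<not> (\<exists>S. finite S \<and> cseq.span S = E)"

definition null_sequences :: "cseq set"
  where "null_sequences = {x. x \<longlonglongrightarrow> 0}"

abbreviation e_set :: "nat set \<Rightarrow> cseq"
  where "e_set N \<equiv> indicator N"


section \<open>Koethe spaces\<close>

definition kothe_matrix :: "(nat \<Rightarrow> nat \<Rightarrow> real) \<Rightarrow> bool"
  where "kothe_matrix a \<longleftrightarrow>
    (\<forall>j q. 0 \<le> a j q) \<and> (\<forall>j. \<exists>q. a j q > 0) \<and> (\<forall>j q. a j q \<le> a j (Suc q))"

definition kothe_space :: "(nat \<Rightarrow> nat \<Rightarrow> real) \<Rightarrow> cseq set"
  where "kothe_space a = {x. \<forall>q. bdd_above (range (\<lambda>j. norm (x j) * a j q))}"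

definition kothe_seminorm :: "(nat \<Rightarrow> nat \<Rightarrow> real) \<Rightarrow> nat \<Rightarrow> cseq \<Rightarrow> real"
  where "kothe_seminorm a q x = (SUP j. norm (x j) * a j q)"

definition kothe_topology :: "(nat \<Rightarrow> nat \<Rightarrow> real) \<Rightarrow> cseq topology"
  where "kothe_topology a = topology_generated_by
    {{y \<in> kothe_space a. kothe_seminorm a q (y - x) < r} | q x r. x \<in> kothe_space a \<and> r > 0}"

lemma topspace_kothe_topology [simp]: "topspace (kothe_topology a) = kothe_space a"
proof
  show "topspace (kothe_topology a) \<subseteq> kothe_space a"
    unfolding kothe_topology_def topology_generated_by_topspace by blast
next
  show "kothe_space a \<subseteq> topspace (kothe_topology a)"
  proof
    fix x assume x: "x \<in> kothe_space a"
    have "kothe_seminorm a 0 (x - x) < 1"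
      by (simp add: kothe_seminorm_def)
    with x have "x \<in> {y \<in> kothe_space a. kothe_seminorm a 0 (y - x) < 1}"
      by simp
    moreover have "{y \<in> kothe_space a. kothe_seminorm a 0 (y - x) < 1} \<in>
        {{y \<in> kothe_space a. kothe_seminorm a q (y - x) < r} | q x r. x \<in> kothe_space a \<and> r > 0}"
      unfolding mem_Collect_eq using x zero_less_one by blast
    ultimately show "x \<in> topspace (kothe_topology a)"
      unfolding kothe_topology_def topology_generated_by_topspace by (rule UnionI[rotated])
  qed
qed


section \<open>Nuclear spaces\<close>

text \<open>
  Here and below, a topology \<open>T\<close> stands for the topological vector space with carrier
  \<^term>\<open>topspace T\<close>, a linear subspace of the space of all complex sequences.
\<close>

definition continuous_seminorm :: "cseq topology \<Rightarrow> (cseq \<Rightarrow> real) \<Rightarrow> bool"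
  where "continuous_seminorm T p \<longleftrightarrow>
    (\<forall>x\<in>topspace T. 0 \<le> p x) \<and>
    (\<forall>x\<in>topspace T. \<forall>y\<in>topspace T. p (x + y) \<le> p x + p y) \<and>
    (\<forall>c. \<forall>x\<in>topspace T. p (cscale c x) = norm c * p x) \<and>
    continuous_map T euclideanreal p"

definition linear_functional_on :: "cseq set \<Rightarrow> (cseq \<Rightarrow> complex) \<Rightarrow> bool"
  where "linear_functional_on V f \<longleftrightarrow>
    (\<forall>x\<in>V. \<forall>y\<in>V. f (x + y) = f x + f y) \<and> (\<forall>c. \<forall>x\<in>V. f (cscale c x) = c * f x)"

text \<open>
  The local Banach space of a seminorm \<open>p\<close> on \<open>V\<close> is the completion of \<open>V\<close> modulo the kernel
  of \<open>p\<close>. Its elements are represented by the \<open>p\<close>-Cauchy sequences \<open>z\<close> in \<open>V\<close>, with norm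
  \<open>lim p (z m)\<close>; an element \<open>x\<close> of \<open>V\<close> is represented by the constant sequence.
\<close>

definition completion_rep :: "cseq set \<Rightarrow> (cseq \<Rightarrow> real) \<Rightarrow> (nat \<Rightarrow> cseq) \<Rightarrow> bool"
  where "completion_rep V p z \<longleftrightarrow>
    range z \<subseteq> V \<and> (\<forall>e>0. \<exists>M. \<forall>m\<ge>M. \<forall>n\<ge>M. p (z m - z n) < e)"

definition completion_norm :: "(cseq \<Rightarrow> real) \<Rightarrow> (nat \<Rightarrow> cseq) \<Rightarrow> real"
  where "completion_norm p z = lim (\<lambda>m. p (z m))"

text \<open>
  For continuous seminorms \<open>p \<le> r\<close>, the canonical map from the local Banach space of \<open>r\<close> to that
  of \<open>p\<close> is nuclear if it has the form \<open>x \<mapsto> (\<Sum>n. f n x *\<^sub>C y n)\<close> with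
  \<open>(\<Sum>n. \<parallel>f n\<parallel> * \<parallel>y n\<parallel>) < \<infinity>\<close>. Functionals in the dual of the local Banach space of \<open>r\<close> are
  the \<open>r\<close>-bounded functionals on \<open>V\<close> (\<open>C n\<close> bounds the norm of \<open>f n\<close>), and it suffices to state
  the representation on the dense image of \<open>V\<close>.
\<close>

definition nuclear_canonical_map :: "cseq set \<Rightarrow> (cseq \<Rightarrow> real) \<Rightarrow> (cseq \<Rightarrow> real) \<Rightarrow> bool"
  where "nuclear_canonical_map V r p \<longleftrightarrow>
    (\<exists>(f :: nat \<Rightarrow> cseq \<Rightarrow> complex) (C :: nat \<Rightarrow> real) (y :: nat \<Rightarrow> nat \<Rightarrow> cseq).
      (\<forall>n. linear_functional_on V (f n) \<and> 0 \<le> C n \<and> (\<forall>x\<in>V. norm (f n x) \<le> C n * r x)) \<and>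
      (\<forall>n. completion_rep V p (y n)) \<and>
      summable (\<lambda>n. C n * completion_norm p (y n)) \<and>
      (\<forall>x\<in>V. (\<lambda>k. completion_norm p (\<lambda>m. x - (\<Sum>n<k. cscale (f n x) (y n m)))) \<longlonglongrightarrow> 0))"

definition nuclear_space :: "cseq topology \<Rightarrow> bool"
  where "nuclear_space T \<longleftrightarrow>
    (\<forall>p. continuous_seminorm T p \<longrightarrow>
      (\<exists>r. continuous_seminorm T r \<and> (\<forall>x\<in>topspace T. p x \<le> r x) \<and>
           nuclear_canonical_map (topspace T) r p))"


section \<open>Schauder bases\<close>

definition expansion :: "cseq topology \<Rightarrow> (nat \<Rightarrow> cseq) \<Rightarrow> cseq \<Rightarrow> (nat \<Rightarrow> complex) \<Rightarrow> bool"
  where "expansion T b x c \<longleftrightarrow> limitin T (\<lambda>n. \<Sum>k<n. cscale (c k) (b k)) x sequentially"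

text \<open>
  The continuity of the coefficient functionals is part of the definition of a Schauder basis in
  a general topological vector space; in Frechet spaces it is automatic.
\<close>

definition schauder_basis :: "cseq topology \<Rightarrow> (nat \<Rightarrow> cseq) \<Rightarrow> bool"
  where "schauder_basis T b \<longleftrightarrow>
    range b \<subseteq> topspace T \<and>
    (\<forall>x\<in>topspace T. \<exists>!c. expansion T b x c) \<and>
    (\<forall>k. continuous_map T euclidean (\<lambda>x. (THE c. expansion T b x c) k))"


section \<open>Star-subalgebras and isomorphisms\<close>

text \<open>Subalgebras need not be unital.\<close>

definition closed_star_subalgebra :: "cseq topology \<Rightarrow> cseq set \<Rightarrow> bool"
  where "closed_star_subalgebra T E \<longleftrightarrow>
    closedin T E \<and> cseq.subspace E \<and>
    (\<forall>x\<in>E. \<forall>y\<in>E. x * y \<in> E) \<and> (\<forall>x\<in>E. cconj x \<in> E)"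

definition frechet_star_algebra_iso :: "cseq topology \<Rightarrow> cseq topology \<Rightarrow> (cseq \<Rightarrow> cseq) \<Rightarrow> bool"
  where "frechet_star_algebra_iso T T' \<phi> \<longleftrightarrow>
    homeomorphic_map T T' \<phi> \<and>
    (\<forall>x\<in>topspace T. \<forall>y\<in>topspace T. \<phi> (x + y) = \<phi> x + \<phi> y \<and> \<phi> (x * y) = \<phi> x * \<phi> y) \<and>
    (\<forall>c. \<forall>x\<in>topspace T. \<phi> (cscale c x) = cscale c (\<phi> x)) \<and>
    (\<forall>x\<in>topspace T. \<phi> (cconj x) = cconj (\<phi> x))"

definition finite_disjoint_family :: "(nat \<Rightarrow> nat set) \<Rightarrow> bool"
  where "finite_disjoint_family N \<longleftrightarrow>
    (\<forall>k. finite (N k) \<and> N k \<noteq> {}) \<and> disjoint_family N"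

definition block_max :: "(nat \<Rightarrow> nat \<Rightarrow> real) \<Rightarrow> (nat \<Rightarrow> nat set) \<Rightarrow> nat \<Rightarrow> nat \<Rightarrow> real"
  where "block_max a N = (\<lambda>k q. Max ((\<lambda>j. a j q) ` N k))"

end

theory Submission
  imports Defs
begin

text \<open>
  For a family \<open>N\<close> of finite disjoint blocks let \<open>block_space a N\<close> be the set of sequences in the
  Koethe space of \<open>a\<close> that are constant on every block and vanish outside the blocks. Both halves
  of the theorem reduce to this space.

  The map that reads off the value on each block preserves every seminorm when the block maxima are
  taken as the new matrix (\<open>block_bound_iff\<close>). It is therefore a topological isomorphism, and as the
  operations are pointwise it is one of star-algebras (\<open>frechet_star_algebra_iso_block_coeff\<close>).

  That the block indicators form a basis depends on nuclearity. By the Grothendieck-Pietsch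
  criterion (\<open>sum_ratio_le_of_nuclear\<close>) each \<open>q\<close> has an \<open>s\<close> such that, for each \<open>e > 0\<close>, only
  finitely many \<open>j\<close> satisfy \<open>a j q > e * a j s\<close>. Hence the tails of a sequence in the space are
  small in every seminorm, and the partial sums over the blocks converge (\<open>limitin_block_sums\<close>). In
  particular a closed subalgebra that contains the block indicators contains the block space, and
  the block space, itself a closed star-subalgebra, is the one they generate.

  It remains to see that every infinite-dimensional closed star-subalgebra \<open>E\<close> is a block space. Its
  elements are null sequences, so nonzero values are attained on finite level sets, and polynomials
  without constant term in \<open>x \<in> E\<close> approximate the indicators of these level sets
  (\<open>level_set_one_mem\<close>). Products and differences of such indicators produce the indicators of the
  maximal sets on which all of \<open>E\<close> is constant (\<open>fibre_mem\<close>). These sets are the blocks.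
\<close>

section \<open>Pointwise operations on sequences\<close>

lemma cscale_apply [simp]: "cscale c x j = c * x j"
  by (simp add: cscale_def)

lemma cconj_apply [simp]: "cconj x j = cnj (x j)"
  by (simp add: cconj_def)

lemma sum_apply [simp]: "(\<Sum>k\<in>A. f k) j = (\<Sum>k\<in>A. f k j)" for f :: "'i \<Rightarrow> cseq"
  by (induction A rule: infinite_finite_induct) auto

section \<open>The seminorms of a Koethe space\<close>

context
  fixes a :: "nat \<Rightarrow> nat \<Rightarrow> real"
  assumes kothe: "kothe_matrix a"
begin

lemma kothe_matrix_nonneg [simp]: "0 \<le> a j q"
  using kothe by (simp add: kothe_matrix_def)

lemma kothe_matrix_mono: "q \<le> s \<Longrightarrow> a j q \<le> a j s"
  using kothe lift_Suc_mono_le[of "a j" q s] by (simp add: kothe_matrix_def)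

lemma kothe_matrix_pos: "\<exists>q. 0 < a j q"
  using kothe by (simp add: kothe_matrix_def)

lemma kothe_space_iff: "x \<in> kothe_space a \<longleftrightarrow> (\<forall>q. \<exists>B. \<forall>j. norm (x j) * a j q \<le> B)"
  by (auto simp: kothe_space_def bdd_above_def)

lemma kothe_seminorm_upper: "x \<in> kothe_space a \<Longrightarrow> norm (x j) * a j q \<le> kothe_seminorm a q x"
  unfolding kothe_space_def kothe_seminorm_def by (auto intro: cSUP_upper)

lemma kothe_seminorm_least: "(\<And>j. norm (x j) * a j q \<le> B) \<Longrightarrow> kothe_seminorm a q x \<le> B"
  unfolding kothe_seminorm_def by (auto intro: cSUP_least)

lemma kothe_seminorm_nonneg [simp]: "x \<in> kothe_space a \<Longrightarrow> 0 \<le> kothe_seminorm a q x"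
  using kothe_seminorm_upper[of x 0 q] mult_nonneg_nonneg[OF norm_ge_zero kothe_matrix_nonneg, of "x 0" 0 q]
  by linarith

lemma kothe_seminorm_zero [simp]: "kothe_seminorm a q 0 = 0"
  by (simp add: kothe_seminorm_def)

text \<open>
  Most memberships and estimates below reduce to comparing two sequences coordinatewise.
\<close>

lemma kothe_dominated:
  assumes x: "x \<in> kothe_space a" and le: "\<And>j. norm (y j) \<le> C * norm (x j)"
  shows "y \<in> kothe_space a" "kothe_seminorm a q y \<le> C * kothe_seminorm a q x"
proof -
  have C: "norm (y j) * a j q \<le> C * kothe_seminorm a q x" if "0 \<le> C" for j q
  proof -
    have "norm (y j) * a j q \<le> C * (norm (x j) * a j q)"
      using mult_right_mono[OF le kothe_matrix_nonneg] by (simp add: mult.assoc)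
    also have "\<dots> \<le> C * kothe_seminorm a q x"
      using that by (intro mult_left_mono kothe_seminorm_upper x)
    finally show ?thesis .
  qed
  have N: "norm (y j) * a j q \<le> C * kothe_seminorm a q x" for j q
  proof (cases "0 \<le> C")
    case False
    have "x i = 0" for i
    proof (rule ccontr)
      assume "x i \<noteq> 0"
      then have "C * norm (x i) < 0" using False by (simp add: mult_less_0_iff)
      then show False using le[of i] norm_ge_zero[of "y i"] by linarith
    qed
    then have "x = 0" "y j = 0"
      using le[of j] by (auto simp: fun_eq_iff)
    then show ?thesis by simp
  qed (rule C)
  show "y \<in> kothe_space a"
    unfolding kothe_space_iff using N by blast
  show "kothe_seminorm a q y \<le> C * kothe_seminorm a q x"
    by (rule kothe_seminorm_least) (rule N)
qed

lemma kothe_add_bound: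
  assumes "x \<in> kothe_space a" "y \<in> kothe_space a"
  shows "norm ((x + y) j) * a j q \<le> kothe_seminorm a q x + kothe_seminorm a q y"
proof -
  have "norm ((x + y) j) * a j q \<le> norm (x j) * a j q + norm (y j) * a j q"
    using mult_right_mono[OF norm_triangle_ineq[of "x j" "y j"] kothe_matrix_nonneg[of j q]]
    by (simp add: algebra_simps)
  then show ?thesis
    using kothe_seminorm_upper[OF assms(1), of j q] kothe_seminorm_upper[OF assms(2), of j q] by simp
qed

lemma kothe_seminorm_triangle:
  "x \<in> kothe_space a \<Longrightarrow> y \<in> kothe_space a \<Longrightarrow>
    kothe_seminorm a q (x + y) \<le> kothe_seminorm a q x + kothe_seminorm a q y"
  by (intro kothe_seminorm_least kothe_add_bound)

lemma kothe_space_add: "x \<in> kothe_space a \<Longrightarrow> y \<in> kothe_space a \<Longrightarrow> x + y \<in> kothe_space a"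
  using kothe_add_bound[of x y] unfolding kothe_space_iff[of "x + y"] by blast

lemma kothe_space_scale: "x \<in> kothe_space a \<Longrightarrow> cscale c x \<in> kothe_space a"
  by (rule kothe_dominated(1)[of x _ "norm c"]) (auto simp: norm_mult)

lemma kothe_space_zero: "0 \<in> kothe_space a"
  by (auto simp: kothe_space_iff)

lemma kothe_space_subspace: "cseq.subspace (kothe_space a)"
  unfolding cseq.subspace_def by (simp add: kothe_space_add kothe_space_scale kothe_space_zero)

lemmas kothe_space_diff = cseq.subspace_diff[OF kothe_space_subspace]
  and kothe_space_sum = cseq.subspace_sum[OF kothe_space_subspace]

lemma kothe_seminorm_scale:
  assumes x: "x \<in> kothe_space a"
  shows "kothe_seminorm a q (cscale c x) = norm c * kothe_seminorm a q x"
proof (rule antisym)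
  show "kothe_seminorm a q (cscale c x) \<le> norm c * kothe_seminorm a q x"
    using kothe_dominated(2)[OF x, of "cscale c x" "norm c" q] by (simp add: norm_mult)
  show "norm c * kothe_seminorm a q x \<le> kothe_seminorm a q (cscale c x)"
  proof (cases "c = 0")
    case True
    then show ?thesis using kothe_space_scale[OF x] by simp
  next
    case False
    have "kothe_seminorm a q x \<le> inverse (norm c) * kothe_seminorm a q (cscale c x)"
      by (rule kothe_dominated(2)[OF kothe_space_scale[OF x]])
         (use False in \<open>simp add: norm_mult field_simps\<close>)
    then show ?thesis
      using False by (simp add: field_simps)
  qed
qed

lemma kothe_seminorm_minus_commute: "kothe_seminorm a q (x - y) = kothe_seminorm a q (y - x)"
  by (simp add: kothe_seminorm_def norm_minus_commute)

lemma kothe_seminorm_diff_triangle: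
  assumes "x \<in> kothe_space a" "y \<in> kothe_space a" "z \<in> kothe_space a"
  shows "kothe_seminorm a q (x - z) \<le> kothe_seminorm a q (x - y) + kothe_seminorm a q (y - z)"
  using kothe_seminorm_triangle[of "x - y" "y - z" q] assms by (simp add: kothe_space_diff)

lemma kothe_seminorm_reverse_triangle:
  assumes "x \<in> kothe_space a" "y \<in> kothe_space a"
  shows "\<bar>kothe_seminorm a q x - kothe_seminorm a q y\<bar> \<le> kothe_seminorm a q (x - y)"
  using kothe_seminorm_diff_triangle[of x y 0 q] kothe_seminorm_diff_triangle[of y x 0 q] assms
  by (simp add: kothe_space_zero kothe_seminorm_minus_commute[of q y x])

lemma kothe_seminorm_mono:
  assumes "x \<in> kothe_space a" "q \<le> s"
  shows "kothe_seminorm a q x \<le> kothe_seminorm a s x"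
proof (rule kothe_seminorm_least)
  fix j
  show "norm (x j) * a j q \<le> kothe_seminorm a s x"
    using mult_left_mono[OF kothe_matrix_mono[OF assms(2), of j], of "norm (x j)"]
      kothe_seminorm_upper[OF assms(1), of j s] by simp
qed

lemma kothe_space_finite_support:
  assumes "finite S" "\<And>j. j \<notin> S \<Longrightarrow> x j = 0"
  shows "x \<in> kothe_space a"
  unfolding kothe_space_iff
proof
  fix q
  have "norm (x j) * a j q \<le> (\<Sum>i\<in>S. norm (x i) * a i q)" for j
    using assms member_le_sum[of j S "\<lambda>i. norm (x i) * a i q"]
    by (cases "j \<in> S") (auto intro: sum_nonneg)
  then show "\<exists>B. \<forall>j. norm (x j) * a j q \<le> B" by blast
qed

section \<open>The topology of a Koethe space\<close>

text \<open>
  The seminorms increase with their index, so finitely many of them are dominated by one. Hence the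
  balls, which generate the topology as a subbase, already form a base.
\<close>

lemma openin_kothe_topology:
  "openin (kothe_topology a) U \<longleftrightarrow> U \<subseteq> kothe_space a \<and>
    (\<forall>x\<in>U. \<exists>q. \<exists>r>0. {y \<in> kothe_space a. kothe_seminorm a q (y - x) < r} \<subseteq> U)"
    (is "_ \<longleftrightarrow> ?open U")
proof
  let ?B = "\<lambda>q x r. {y \<in> kothe_space a. kothe_seminorm a q (y - x) < r}"
  assume "openin (kothe_topology a) U"
  then have gen: "generate_topology_on {?B q x r | q x r. x \<in> kothe_space a \<and> r > 0} U"
    unfolding kothe_topology_def by (rule openin_topology_generated_by)
  have "istopology ?open"
    unfolding istopology_def
  proof (intro conjI allI impI)
    fix S T assume ST: "?open S" "?open T"
    show "S \<inter> T \<subseteq> kothe_space a" using ST by blast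
    show "\<forall>x\<in>S \<inter> T. \<exists>q. \<exists>r>0. ?B q x r \<subseteq> S \<inter> T"
    proof
      fix x assume "x \<in> S \<inter> T"
      then obtain q r q' r' where *: "r > 0" "?B q x r \<subseteq> S" "r' > 0" "?B q' x r' \<subseteq> T"
        and x: "x \<in> kothe_space a"
        using ST by blast
      have "?B (max q q') x (min r r') \<subseteq> ?B q x r \<inter> ?B q' x r'"
      proof
        fix y assume "y \<in> ?B (max q q') x (min r r')"
        then show "y \<in> ?B q x r \<inter> ?B q' x r'"
          using kothe_seminorm_mono[OF kothe_space_diff[of y x], of q "max q q'"]
            kothe_seminorm_mono[OF kothe_space_diff[of y x], of q' "max q q'"] x by auto
      qed
      then show "\<exists>q. \<exists>r>0. ?B q x r \<subseteq> S \<inter> T"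
        using * by (intro exI[of _ "max q q'"] exI[of _ "min r r'"]) auto
    qed
  next
    fix K assume "\<forall>S\<in>K. ?open S"
    then show "\<Union>K \<subseteq> kothe_space a" by blast
    show "\<forall>x\<in>\<Union>K. \<exists>q. \<exists>r>0. ?B q x r \<subseteq> \<Union>K"
    proof
      fix x assume "x \<in> \<Union>K"
      then obtain S where S: "S \<in> K" "x \<in> S" by blast
      then obtain q r where "r > 0" "?B q x r \<subseteq> S"
        using \<open>\<forall>S\<in>K. ?open S\<close> by blast
      moreover have "S \<subseteq> \<Union>K" using S by blast
      ultimately show "\<exists>q. \<exists>r>0. ?B q x r \<subseteq> \<Union>K"
        using order.trans by blast
    qed
  qed
  then show "?open U"
  proof (rule generate_topology_on_coarsest[OF _ _ gen])
    fix S assume "S \<in> {?B q x r | q x r. x \<in> kothe_space a \<and> r > 0}"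
    then obtain q x r where S: "S = ?B q x r" and x: "x \<in> kothe_space a" by blast
    have "?B q y (r - kothe_seminorm a q (y - x)) \<subseteq> S" if "y \<in> S" for y
      using that kothe_seminorm_diff_triangle[of _ y x q] x unfolding S by fastforce
    moreover have "r - kothe_seminorm a q (y - x) > 0" if "y \<in> S" for y
      using that by (simp add: S)
    moreover have "S \<subseteq> kothe_space a" by (auto simp: S)
    ultimately show "?open S"
      by blast
  qed
next
  let ?B = "\<lambda>q x r. {y \<in> kothe_space a. kothe_seminorm a q (y - x) < r}"
  assume U: "?open U"
  show "openin (kothe_topology a) U"
  proof (subst openin_subopen, intro ballI)
    fix x assume x: "x \<in> U"
    then obtain q r where r: "r > 0" "?B q x r \<subseteq> U" using U by blast
    have "openin (kothe_topology a) (?B q x r)"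
      unfolding kothe_topology_def
      by (rule topology_generated_by_Basis) (use r x U in blast)
    moreover have "x \<in> ?B q x r" using x U r by auto
    ultimately show "\<exists>T. openin (kothe_topology a) T \<and> x \<in> T \<and> T \<subseteq> U"
      using r by blast
  qed
qed

lemma openin_kothe_ball:
  "x \<in> kothe_space a \<Longrightarrow> 0 < r \<Longrightarrow>
    openin (kothe_topology a) {y \<in> kothe_space a. kothe_seminorm a q (y - x) < r}"
  unfolding kothe_topology_def by (rule topology_generated_by_Basis) blast

lemma limitin_kothe_topology:
  assumes x: "x \<in> kothe_space a" and f: "\<And>n. f n \<in> kothe_space a"
    and lim: "\<And>q. (\<lambda>n. kothe_seminorm a q (f n - x)) \<longlonglongrightarrow> 0"
  shows "limitin (kothe_topology a) f x sequentially"
  unfolding limitin_def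
proof (intro conjI allI impI)
  show "x \<in> topspace (kothe_topology a)" using x by simp
  fix U assume "openin (kothe_topology a) U \<and> x \<in> U"
  then obtain q r where r: "r > 0" "{y \<in> kothe_space a. kothe_seminorm a q (y - x) < r} \<subseteq> U"
    unfolding openin_kothe_topology by blast
  have "\<forall>\<^sub>F n in sequentially. kothe_seminorm a q (f n - x) < r"
    using order_tendstoD(2)[OF lim r(1)] .
  then show "\<forall>\<^sub>F n in sequentially. f n \<in> U"
    by eventually_elim (use r f in blast)
qed

lemma continuous_map_kothe_topologyI:
  fixes f :: "cseq \<Rightarrow> 'b"
  assumes W: "W \<subseteq> kothe_space a" and f: "\<And>x. x \<in> W \<Longrightarrow> f x \<in> topspace Y"
    and nbh: "\<And>x U. x \<in> W \<Longrightarrow> openin Y U \<Longrightarrow> f x \<in> U \<Longrightarrow>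
      \<exists>q. \<exists>r>0. \<forall>y\<in>W. kothe_seminorm a q (y - x) < r \<longrightarrow> f y \<in> U"
  shows "continuous_map (subtopology (kothe_topology a) W) Y f"
  unfolding continuous_map_def
proof (intro conjI allI impI)
  show "f \<in> topspace (subtopology (kothe_topology a) W) \<rightarrow> topspace Y"
    using f by auto
  fix U assume U: "openin Y U"
  let ?P = "{x \<in> topspace (subtopology (kothe_topology a) W). f x \<in> U}"
  show "openin (subtopology (kothe_topology a) W) ?P"
  proof (subst openin_subopen, intro ballI)
    fix x assume x: "x \<in> ?P"
    then have "x \<in> W" "f x \<in> U" by auto
    from nbh[OF this(1) U this(2)]
    obtain q r where r: "r > 0" "\<forall>y\<in>W. kothe_seminorm a q (y - x) < r \<longrightarrow> f y \<in> U"
      by blast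
    let ?T = "{y \<in> kothe_space a. kothe_seminorm a q (y - x) < r} \<inter> W"
    have "openin (subtopology (kothe_topology a) W) ?T"
      using x r(1) by (intro openin_subtopology_Int openin_kothe_ball) auto
    moreover have "x \<in> ?T" "?T \<subseteq> ?P"
      using x r by auto
    ultimately show "\<exists>T. openin (subtopology (kothe_topology a) W) T \<and> x \<in> T \<and> T \<subseteq> ?P"
      by blast
  qed
qed

text \<open>
  The matrix has a positive entry in row \<open>j\<close>, so some seminorm controls the \<open>j\<close>-th coordinate.
\<close>

lemma continuous_map_kothe_coordinate:
  assumes "W \<subseteq> kothe_space a"
  shows "continuous_map (subtopology (kothe_topology a) W) euclidean (\<lambda>x. x j)"
proof (rule continuous_map_kothe_topologyI[OF assms])
  fix x :: cseq and U assume x: "x \<in> W" and "openin euclidean U" "x j \<in> U"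
  then obtain e where e: "e > 0" "\<And>z. dist z (x j) < e \<Longrightarrow> z \<in> U"
    by (auto simp: open_dist)
  obtain q where q: "0 < a j q" using kothe_matrix_pos by blast
  have "y j \<in> U" if "y \<in> W" "kothe_seminorm a q (y - x) < e * a j q" for y
  proof (rule e(2))
    have "norm ((y - x) j) * a j q < e * a j q"
      using kothe_seminorm_upper[OF kothe_space_diff[of y x], of j q] that x assms
      by (meson le_less_trans subsetD)
    then show "dist (y j) (x j) < e"
      using q by (simp add: dist_norm)
  qed
  then show "\<exists>q. \<exists>r>0. \<forall>y\<in>W. kothe_seminorm a q (y - x) < r \<longrightarrow> y j \<in> U"
    using q e(1) mult_pos_pos[OF e(1) q] by blast
qed auto

lemma limitin_kothe_coordinate:
  assumes "limitin (kothe_topology a) f x sequentially"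
  shows "(\<lambda>n. f n j) \<longlonglongrightarrow> x j"
proof -
  have "continuous_map (kothe_topology a) euclidean (\<lambda>x. x j)"
    using continuous_map_kothe_coordinate[OF order.refl, of j]
      subtopology_topspace[of "kothe_topology a"] by simp
  from continuous_map_limit[OF this assms] show ?thesis
    by (simp add: o_def)
qed

lemma continuous_seminorm_kothe_seminorm: "continuous_seminorm (kothe_topology a) (kothe_seminorm a q)"
proof -
  have "continuous_map (subtopology (kothe_topology a) (kothe_space a)) euclideanreal (kothe_seminorm a q)"
  proof (rule continuous_map_kothe_topologyI[OF order.refl])
    fix x :: cseq and U :: "real set"
    assume x: "x \<in> kothe_space a" and "openin euclidean U" "kothe_seminorm a q x \<in> U"
    then obtain e where e: "e > 0" "\<And>z. dist z (kothe_seminorm a q x) < e \<Longrightarrow> z \<in> U"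
      by (auto simp: open_dist)
    have "kothe_seminorm a q y \<in> U"
      if "y \<in> kothe_space a" "kothe_seminorm a q (y - x) < e" for y
      using kothe_seminorm_reverse_triangle[OF that(1) x, of q] that(2)
      by (intro e(2)) (simp add: dist_real_def)
    then show "\<exists>q'. \<exists>r>0. \<forall>y\<in>kothe_space a. kothe_seminorm a q' (y - x) < r \<longrightarrow> kothe_seminorm a q y \<in> U"
      using e(1) by blast
  qed auto
  then have "continuous_map (kothe_topology a) euclideanreal (kothe_seminorm a q)"
    using subtopology_topspace[of "kothe_topology a"] by simp
  then show ?thesis
    unfolding continuous_seminorm_def by (simp add: kothe_seminorm_triangle kothe_seminorm_scale)
qed

text \<open>
  The open unit ball of \<open>r\<close> contains a ball around 0 for one of the defining seminorms; scaling
  turns the inclusion of balls into an inequality.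
\<close>

lemma continuous_seminorm_bounded:
  assumes r: "continuous_seminorm (kothe_topology a) r"
  obtains s C where "0 < C" "\<And>x. x \<in> kothe_space a \<Longrightarrow> r x \<le> C * kothe_seminorm a s x"
proof -
  have hom: "\<And>c x. x \<in> kothe_space a \<Longrightarrow> r (cscale c x) = norm c * r x"
    and cont: "continuous_map (kothe_topology a) euclideanreal r"
    using r by (auto simp: continuous_seminorm_def)
  have "r 0 = 0"
    using hom[of 0 0] kothe_space_zero by (simp add: cscale_def zero_fun_def)
  moreover have "openin (kothe_topology a) {x \<in> topspace (kothe_topology a). r x \<in> {..<1}}"
    using cont by (rule openin_continuous_map_preimage) auto
  ultimately have "openin (kothe_topology a) {x \<in> kothe_space a. r x < 1}"
    "0 \<in> {x \<in> kothe_space a. r x < 1}"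
    using kothe_space_zero by simp_all
  then obtain s d where d: "d > 0"
    "{y \<in> kothe_space a. kothe_seminorm a s (y - 0) < d} \<subseteq> {x \<in> kothe_space a. r x < 1}"
    unfolding openin_kothe_topology by blast
  have "r x \<le> inverse d * kothe_seminorm a s x" if x: "x \<in> kothe_space a" for x
  proof (rule dense_ge)
    fix u assume u: "inverse d * kothe_seminorm a s x < u"
    have u0: "u > 0"
      using u mult_nonneg_nonneg[OF _ kothe_seminorm_nonneg[OF x], of "inverse d" s] d(1) by simp
    let ?y = "cscale (of_real (inverse u)) x"
    have "kothe_seminorm a s ?y < d"
      using u u0 d(1) by (simp add: kothe_seminorm_scale x field_simps norm_inverse norm_divide)
    then have "r ?y < 1"
      using d(2) kothe_space_scale[OF x] by auto
    then show "r x \<le> u"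
      using u0 by (simp add: hom x field_simps norm_inverse norm_divide)
  qed
  then show ?thesis
    using that[of "inverse d" s] d(1) by simp
qed

section \<open>Nuclearity\<close>

lemma completion_norm_tendsto:
  assumes z: "completion_rep (kothe_space a) (kothe_seminorm a q) z"
  shows "(\<lambda>m. kothe_seminorm a q (z m)) \<longlonglongrightarrow> completion_norm (kothe_seminorm a q) z"
proof -
  have V: "z m \<in> kothe_space a" for m
    using z by (auto simp: completion_rep_def)
  have "Cauchy (\<lambda>m. kothe_seminorm a q (z m))"
  proof (rule CauchyI)
    fix e :: real assume "e > 0"
    then obtain M where "\<forall>m\<ge>M. \<forall>n\<ge>M. kothe_seminorm a q (z m - z n) < e"
      using z by (auto simp: completion_rep_def)
    then show "\<exists>M. \<forall>m\<ge>M. \<forall>n\<ge>M. norm (kothe_seminorm a q (z m) - kothe_seminorm a q (z n)) < e"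
      using kothe_seminorm_reverse_triangle[OF V V, of q] unfolding real_norm_def
      by (blast intro: le_less_trans)
  qed
  then show ?thesis
    unfolding completion_norm_def by (simp add: Cauchy_convergent convergent_LIMSEQ_iff[symmetric])
qed

text \<open>
  The residuals in the definition of a nuclear map are built from finitely many such steps, so they
  again represent elements of the local Banach space and their completion norms are limits.
\<close>

lemma completion_rep_diff_scale:
  assumes z: "completion_rep (kothe_space a) (kothe_seminorm a q) z"
    and y: "completion_rep (kothe_space a) (kothe_seminorm a q) y"
  shows "completion_rep (kothe_space a) (kothe_seminorm a q) (\<lambda>m. z m - cscale c (y m))"
proof -
  have V: "z m \<in> kothe_space a" "y m \<in> kothe_space a" for m
    using z y by (auto simp: completion_rep_def)
  have "\<exists>M. \<forall>m\<ge>M. \<forall>n\<ge>M. kothe_seminorm a q (z m - cscale c (y m) - (z n - cscale c (y n))) < e"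
    if e: "e > 0" for e
  proof -
    have c: "0 < norm c + 1" by (simp add: add_nonneg_pos)
    have "e / 2 > 0" "e / (2 * (norm c + 1)) > 0"
      using e c by simp_all
    then obtain M1 M2
      where M1: "\<forall>m\<ge>M1. \<forall>n\<ge>M1. kothe_seminorm a q (z m - z n) < e / 2"
        and M2: "\<forall>m\<ge>M2. \<forall>n\<ge>M2. kothe_seminorm a q (y m - y n) < e / (2 * (norm c + 1))"
      using z y unfolding completion_rep_def by meson
    have "kothe_seminorm a q (z m - cscale c (y m) - (z n - cscale c (y n))) < e"
      if "m \<ge> max M1 M2" "n \<ge> max M1 M2" for m n
    proof -
      have eq: "z m - cscale c (y m) - (z n - cscale c (y n)) = (z m - z n) + cscale (- c) (y m - y n)"
        by (auto simp: fun_eq_iff algebra_simps)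
      have "kothe_seminorm a q (z m - cscale c (y m) - (z n - cscale c (y n)))
          \<le> kothe_seminorm a q (z m - z n) + kothe_seminorm a q (cscale (- c) (y m - y n))"
        unfolding eq by (intro kothe_seminorm_triangle kothe_space_scale kothe_space_diff V)
      also have "\<dots> = kothe_seminorm a q (z m - z n) + norm c * kothe_seminorm a q (y m - y n)"
        by (subst kothe_seminorm_scale) (simp_all add: kothe_space_diff V)
      also have "\<dots> < e / 2 + (norm c + 1) * (e / (2 * (norm c + 1)))"
      proof (rule add_less_le_mono)
        show "kothe_seminorm a q (z m - z n) < e / 2"
          using M1 that by auto
        have "kothe_seminorm a q (y m - y n) \<le> e / (2 * (norm c + 1))"
          using M2 that by (auto intro: less_imp_le)
        then show "norm c * kothe_seminorm a q (y m - y n) \<le> (norm c + 1) * (e / (2 * (norm c + 1)))"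
          by (intro mult_mono) (auto simp: kothe_space_diff V)
      qed
      also have "\<dots> = e"
        using c by (simp add: field_simps)
      finally show ?thesis .
    qed
    then show ?thesis by blast
  qed
  moreover have "range (\<lambda>m. z m - cscale c (y m)) \<subseteq> kothe_space a"
    using V by (auto intro!: kothe_space_diff kothe_space_scale)
  ultimately show ?thesis
    unfolding completion_rep_def by blast
qed

lemma completion_rep_diff_sum:
  fixes y :: "nat \<Rightarrow> nat \<Rightarrow> cseq"
  assumes x: "x \<in> kothe_space a"
    and y: "\<And>n. completion_rep (kothe_space a) (kothe_seminorm a q) (y n)"
  shows "completion_rep (kothe_space a) (kothe_seminorm a q)
    (\<lambda>m. x - (\<Sum>n<k. cscale (c n) (y n m)))"
proof (induction k)
  case 0
  show ?case
    using x by (simp add: completion_rep_def)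
next
  case (Suc k)
  have "x - (\<Sum>n<Suc k. cscale (c n) (y n m)) = x - (\<Sum>n<k. cscale (c n) (y n m)) - cscale (c k) (y k m)"
    for m by (simp only: sum.lessThan_Suc diff_diff_eq)
  then show ?case
    using completion_rep_diff_scale[OF Suc y, of "c k" k] by (simp only:)
qed

text \<open>
  The triangle inequality in the local Banach space, written out for representatives: it holds for
  every index \<open>m\<close> and survives the limit.
\<close>

lemma kothe_seminorm_le_residual:
  fixes y :: "nat \<Rightarrow> nat \<Rightarrow> cseq"
  assumes x: "x \<in> kothe_space a"
    and y: "\<And>n. completion_rep (kothe_space a) (kothe_seminorm a q) (y n)"
  shows "kothe_seminorm a q x \<le>
    completion_norm (kothe_seminorm a q) (\<lambda>m. x - (\<Sum>n<k. cscale (c n) (y n m))) +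
    (\<Sum>n<k. norm (c n) * completion_norm (kothe_seminorm a q) (y n))"
proof (rule LIMSEQ_le_const)
  have V: "y n m \<in> kothe_space a" for n m
    using y by (auto simp: completion_rep_def)
  show "(\<lambda>m. kothe_seminorm a q (x - (\<Sum>n<k. cscale (c n) (y n m))) +
      (\<Sum>n<k. norm (c n) * kothe_seminorm a q (y n m))) \<longlonglongrightarrow>
    completion_norm (kothe_seminorm a q) (\<lambda>m. x - (\<Sum>n<k. cscale (c n) (y n m))) +
    (\<Sum>n<k. norm (c n) * completion_norm (kothe_seminorm a q) (y n))"
    by (intro tendsto_add tendsto_sum tendsto_mult tendsto_const completion_norm_tendsto
        completion_rep_diff_sum x y)
  have *: "kothe_seminorm a q (\<Sum>n<k. cscale (c n) (y n m)) \<le> (\<Sum>n<k. norm (c n) * kothe_seminorm a q (y n m))"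
    for m k
  proof (induction k)
    case (Suc k)
    have "kothe_seminorm a q (\<Sum>n<Suc k. cscale (c n) (y n m)) \<le>
        kothe_seminorm a q (\<Sum>n<k. cscale (c n) (y n m)) + kothe_seminorm a q (cscale (c k) (y k m))"
      unfolding sum.lessThan_Suc by (intro kothe_seminorm_triangle kothe_space_sum kothe_space_scale V)
    also have "kothe_seminorm a q (cscale (c k) (y k m)) = norm (c k) * kothe_seminorm a q (y k m)"
      by (rule kothe_seminorm_scale[OF V])
    finally show ?case
      using Suc unfolding sum.lessThan_Suc[of "\<lambda>n. norm (c n) * kothe_seminorm a q (y n m)"] by linarith
  qed (simp add: zero_fun_def[symmetric])
  have "kothe_seminorm a q x \<le> kothe_seminorm a q (x - (\<Sum>n<k. cscale (c n) (y n m))) +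
      (\<Sum>n<k. norm (c n) * kothe_seminorm a q (y n m))" for m
  proof -
    let ?s = "\<Sum>n<k. cscale (c n) (y n m)"
    have "?s \<in> kothe_space a"
      by (intro kothe_space_sum kothe_space_scale V)
    then have "kothe_seminorm a q x \<le> kothe_seminorm a q (x - ?s) + kothe_seminorm a q ?s"
      using kothe_seminorm_triangle[of "x - ?s" ?s q] x by (simp add: kothe_space_diff)
    then show ?thesis using *[of m k] by linarith
  qed
  then show "\<exists>M. \<forall>m\<ge>M. kothe_seminorm a q x \<le> kothe_seminorm a q (x - (\<Sum>n<k. cscale (c n) (y n m))) +
      (\<Sum>n<k. norm (c n) * kothe_seminorm a q (y n m))"
    by blast
qed

end

lemma linear_functional_on_sum:
  assumes f: "linear_functional_on V f" and V: "cseq.subspace V" and "finite J"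
    and x: "\<And>j. j \<in> J \<Longrightarrow> x j \<in> V"
  shows "f (\<Sum>j\<in>J. cscale (c j) (x j)) = (\<Sum>j\<in>J. c j * f (x j))"
  using \<open>finite J\<close> x
proof (induction J)
  case empty
  have "f (cscale 0 0) = 0 * f 0"
    using f cseq.subspace_0[OF V] unfolding linear_functional_on_def by blast
  then show ?case by (simp add: cscale_def zero_fun_def)
next
  case (insert i J)
  then have "(\<Sum>j\<in>J. cscale (c j) (x j)) \<in> V" "cscale (c i) (x i) \<in> V"
    by (auto intro!: cseq.subspace_sum cseq.subspace_scale V)
  then have "f (cscale (c i) (x i) + (\<Sum>j\<in>J. cscale (c j) (x j))) =
      f (cscale (c i) (x i)) + f (\<Sum>j\<in>J. cscale (c j) (x j))"
    "f (cscale (c i) (x i)) = c i * f (x i)"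
    using f insert.prems unfolding linear_functional_on_def by blast+
  with insert show ?case
    by (simp only: sum.insert insert_iff simp_thms)
qed

text \<open>
  This is the necessity half of the Grothendieck-Pietsch criterion. Let \<open>x j\<close> be the \<open>j\<close>-th unit
  vector divided by \<open>a j s\<close>, where a multiple of the \<open>s\<close>-th seminorm dominates the domain
  seminorm \<open>r\<close> of a nuclear map. All combinations of the \<open>x j\<close> with coefficients of modulus at
  most 1 lie in a fixed multiple of the unit ball of \<open>r\<close>. Choosing the coefficients as conjugate phases shows that the
  numbers \<open>norm (f n (x j))\<close>, summed over \<open>j\<close>, are at most a constant times \<open>C n\<close>. Since \<open>x j\<close> has
  \<open>q\<close>-th seminorm \<open>a j q / a j s\<close>, summing the nuclear representations of the \<open>x j\<close> bounds the
  sum of these ratios by a constant times \<open>\<Sum>n. C n * \<parallel>y n\<parallel>\<close>.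
\<close>

lemma sum_ratio_le_of_nuclear:
  assumes kothe: "kothe_matrix a"
    and nuclear: "nuclear_space (kothe_topology a)"
  shows "\<exists>s S. q \<le> s \<and>
    (\<forall>J. finite J \<longrightarrow> (\<forall>j\<in>J. 0 < a j s) \<longrightarrow> (\<Sum>j\<in>J. a j q / a j s) \<le> S)"
proof -
  let ?V = "kothe_space a" and ?p = "kothe_seminorm a q"
  note [simp] = kothe_matrix_nonneg[OF kothe]
  obtain r where r: "continuous_seminorm (kothe_topology a) r"
    and ncm: "nuclear_canonical_map ?V r ?p"
    using nuclear continuous_seminorm_kothe_seminorm[OF kothe, of q]
    unfolding nuclear_space_def topspace_kothe_topology by blast
  obtain f C y where f: "\<And>n. linear_functional_on ?V (f n)"
    and C: "\<And>n. 0 \<le> C n" and fC: "\<And>n x. x \<in> ?V \<Longrightarrow> norm (f n x) \<le> C n * r x"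
    and y: "\<And>n. completion_rep ?V ?p (y n)"
    and sm: "summable (\<lambda>n. C n * completion_norm ?p (y n))"
    and lim: "\<And>x. x \<in> ?V \<Longrightarrow>
      (\<lambda>k. completion_norm ?p (\<lambda>m. x - (\<Sum>n<k. cscale (f n x) (y n m)))) \<longlonglongrightarrow> 0"
    using ncm unfolding nuclear_canonical_map_def by blast
  obtain s0 D where D: "0 < D" "\<And>x. x \<in> ?V \<Longrightarrow> r x \<le> D * kothe_seminorm a s0 x"
    using continuous_seminorm_bounded[OF kothe r] by blast
  \<comment> \<open>Taking \<open>s \<ge> q\<close> as well ensures that \<open>a j q\<close> vanishes wherever \<open>a j s\<close> does.\<close>
  define s where "s = max s0 q"
  define Y where "Y n = completion_norm ?p (y n)" for n
  have Y: "0 \<le> Y n" for n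
    unfolding Y_def
  proof (rule LIMSEQ_le_const[OF completion_norm_tendsto[OF kothe y]])
    show "\<exists>N. \<forall>m\<ge>N. 0 \<le> ?p (y n m)"
      using y[of n] by (auto simp: completion_rep_def kothe_seminorm_nonneg[OF kothe] image_subset_iff)
  qed
  define x where "x j = cscale (of_real (inverse (a j s))) (e_set {j})" for j
  have x_V: "x j \<in> ?V" for j
    by (rule kothe_space_finite_support[OF kothe, of "{j}"]) (auto simp: x_def)
  have "(\<Sum>j\<in>J. a j q / a j s) \<le> D * (\<Sum>n. C n * Y n)"
    if J: "finite J" "\<forall>j\<in>J. 0 < a j s" for J
  proof -
    have ratio: "a j q / a j s \<le> ?p (x j)" if "j \<in> J" for j
    proof -
      have "norm (x j j) = inverse (a j s)"
        using J that by (simp add: x_def norm_inverse norm_divide)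
      then show ?thesis
        using kothe_seminorm_upper[OF kothe x_V, of j j q] by (simp add: divide_inverse mult.commute)
    qed
    have functional: "(\<Sum>j\<in>J. norm (f n (x j))) \<le> C n * D" for n
    proof -
      define c where "c j = cnj (sgn (f n (x j)))" for j
      let ?z = "\<Sum>j\<in>J. cscale (c j) (x j)"
      have z_V: "?z \<in> ?V"
        by (intro kothe_space_sum[OF kothe] kothe_space_scale[OF kothe] x_V)
      have "norm (?z i) * a i s0 \<le> 1" for i
      proof (cases "i \<in> J")
        case True
        have "?z i = (\<Sum>j\<in>J. if j = i then c i * of_real (inverse (a i s)) else 0)"
          unfolding sum_apply by (intro sum.cong) (auto simp: x_def)
        then have "norm (?z i) = norm (c i) * inverse (a i s)"
          using J True by (simp add: norm_mult norm_inverse less_imp_le)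
        also have "\<dots> \<le> inverse (a i s)"
          using J True by (simp add: c_def norm_sgn)
        finally have "norm (?z i) * a i s0 \<le> inverse (a i s) * a i s"
          using J True by (intro mult_mono kothe_matrix_mono[OF kothe]) (auto simp: s_def)
        then show ?thesis using J True by auto
      next
        case False
        then have "?z i = 0"
          unfolding sum_apply by (intro sum.neutral) (auto simp: x_def indicator_def)
        then show ?thesis by simp
      qed
      then have z1: "kothe_seminorm a s0 ?z \<le> 1"
        by (rule kothe_seminorm_least[OF kothe])
      have "f n ?z = (\<Sum>j\<in>J. c j * f n (x j))"
        by (rule linear_functional_on_sum[OF f kothe_space_subspace[OF kothe] J(1) x_V])
      also have "\<dots> = (\<Sum>j\<in>J. of_real (norm (f n (x j))))"
        by (intro sum.cong) (auto simp: c_def sgn_div_norm complex_norm_square[symmetric]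
            scaleR_conv_of_real power2_eq_square field_simps)
      finally have "(\<Sum>j\<in>J. norm (f n (x j))) = norm (f n ?z)"
        by (simp add: sum_nonneg flip: of_real_sum)
      also have "\<dots> \<le> C n * r ?z" by (rule fC[OF z_V])
      also have "\<dots> \<le> C n * D"
      proof (rule mult_left_mono[OF _ C])
        show "r ?z \<le> D"
          using D(2)[OF z_V] mult_left_mono[OF z1, of D] D(1) by linarith
      qed
      finally show ?thesis .
    qed
    define res where "res k j = completion_norm ?p (\<lambda>m. x j - (\<Sum>n<k. cscale (f n (x j)) (y n m)))" for k j
    have "(\<lambda>k. (\<Sum>j\<in>J. res k j) + D * (\<Sum>n. C n * Y n)) \<longlonglongrightarrow> 0 + D * (\<Sum>n. C n * Y n)"
      by (intro tendsto_add tendsto_const tendsto_null_sum) (simp add: res_def lim x_V)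
    moreover have "(\<Sum>j\<in>J. a j q / a j s) \<le> (\<Sum>j\<in>J. res k j) + D * (\<Sum>n. C n * Y n)" for k
    proof -
      have "(\<Sum>j\<in>J. a j q / a j s) \<le> (\<Sum>j\<in>J. res k j + (\<Sum>n<k. norm (f n (x j)) * Y n))"
      proof (rule sum_mono)
        fix j assume "j \<in> J"
        from ratio[OF this] kothe_seminorm_le_residual[where y = y, OF kothe x_V[of j] y, where k = k and c = "\<lambda>n. f n (x j)"]
        show "a j q / a j s \<le> res k j + (\<Sum>n<k. norm (f n (x j)) * Y n)"
          unfolding res_def Y_def by linarith
      qed
      also have "\<dots> = (\<Sum>j\<in>J. res k j) + (\<Sum>n<k. (\<Sum>j\<in>J. norm (f n (x j))) * Y n)"
        by (simp add: sum.distrib sum.swap[of _ J] sum_distrib_right)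
      also have "(\<Sum>n<k. (\<Sum>j\<in>J. norm (f n (x j))) * Y n) \<le> (\<Sum>n<k. D * (C n * Y n))"
        using mult_right_mono[OF functional Y] by (intro sum_mono) (simp add: mult_ac)
      also have "\<dots> = D * (\<Sum>n<k. C n * Y n)"
        by (simp add: sum_distrib_left)
      also have "\<dots> \<le> D * (\<Sum>n. C n * Y n)"
        using D(1) C Y sm by (intro mult_left_mono sum_le_suminf) (auto simp: Y_def)
      finally show ?thesis by simp
    qed
    ultimately show ?thesis
      using LIMSEQ_le_const by fastforce
  qed
  then show ?thesis
    by (intro exI[of _ s] exI[of _ "D * (\<Sum>n. C n * Y n)"]) (auto simp: s_def)
qed

text \<open>
  Bounded sums of ratios force the ratios to tend to 0. Writing this as finiteness of a set avoids
  dividing by entries that may vanish.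
\<close>

lemma finite_large_ratio_of_nuclear:
  assumes kothe: "kothe_matrix a"
    and nuclear: "nuclear_space (kothe_topology a)"
  shows "\<exists>s. \<forall>e>0. finite {j. e * a j s < a j q}"
proof -
  obtain s S where qs: "q \<le> s"
    and S: "\<And>J. finite J \<Longrightarrow> \<forall>j\<in>J. 0 < a j s \<Longrightarrow> (\<Sum>j\<in>J. a j q / a j s) \<le> S"
    using sum_ratio_le_of_nuclear[OF assms, of q] by blast
  have "finite {j. e * a j s < a j q}" if e: "e > 0" for e :: real
  proof (rule ccontr)
    assume inf: "infinite {j. e * a j s < a j q}"
    obtain n where n: "S < of_nat n * e"
      using reals_Archimedean3[OF e] by blast
    obtain J where J: "J \<subseteq> {j. e * a j s < a j q}" "finite J" "card J = n"
      using infinite_arbitrarily_large[OF inf] by blast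
    have pos: "0 < a j s" if "j \<in> J" for j
    proof -
      have "e * a j s < a j q" using that J by auto
      moreover have "0 \<le> e * a j s" using e kothe_matrix_nonneg[OF kothe, of j s] by simp
      ultimately show ?thesis using kothe_matrix_mono[OF kothe qs, of j] by linarith
    qed
    have "of_nat n * e = (\<Sum>j\<in>J. e)" using J by simp
    also have "\<dots> \<le> (\<Sum>j\<in>J. a j q / a j s)"
      using J pos by (intro sum_mono) (auto simp: field_simps subset_iff intro: less_imp_le)
    also have "\<dots> \<le> S" using S J pos by blast
    finally show False using n by simp
  qed
  then show ?thesis by blast
qed

section \<open>Sequences constant on blocks\<close>

text \<open>
  The blocks are meant to be finite and disjoint, but need not cover the index set.
\<close>

definition block_constant :: "(nat \<Rightarrow> nat set) \<Rightarrow> cseq \<Rightarrow> bool"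
  where "block_constant N x \<longleftrightarrow>
    (\<forall>k. \<forall>i\<in>N k. \<forall>j\<in>N k. x i = x j) \<and> (\<forall>j. j \<notin> (\<Union>k. N k) \<longrightarrow> x j = 0)"

definition block_space :: "(nat \<Rightarrow> nat \<Rightarrow> real) \<Rightarrow> (nat \<Rightarrow> nat set) \<Rightarrow> cseq set"
  where "block_space a N = {x \<in> kothe_space a. block_constant N x}"

definition block_coeff :: "(nat \<Rightarrow> nat set) \<Rightarrow> cseq \<Rightarrow> cseq"
  where "block_coeff N x = (\<lambda>k. x (Min (N k)))"

definition block_spread :: "(nat \<Rightarrow> nat set) \<Rightarrow> cseq \<Rightarrow> cseq"
  where "block_spread N \<xi> = (\<lambda>j. if j \<in> (\<Union>k. N k) then \<xi> (THE k. j \<in> N k) else 0)"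

text \<open>
  Null sequences are bounded, so one factor can be replaced by a constant.
\<close>

lemma kothe_space_mult:
  assumes kothe: "kothe_matrix a" and null: "kothe_space a \<subseteq> null_sequences"
    and x: "x \<in> kothe_space a" and y: "y \<in> kothe_space a"
  shows "x * y \<in> kothe_space a"
proof -
  have "y \<longlonglongrightarrow> 0"
    using null y by (auto simp: null_sequences_def)
  then have "Bseq y"
    by (intro convergent_imp_Bseq convergentI)
  then obtain C where C: "\<And>j. norm (y j) \<le> C"
    unfolding Bseq_def by blast
  show ?thesis
  proof (rule kothe_dominated(1)[OF kothe x])
    show "norm ((x * y) j) \<le> C * norm (x j)" for j
      using mult_right_mono[OF C, of "norm (x j)"] by (simp add: norm_mult mult.commute)
  qed
qed

context
  fixes N :: "nat \<Rightarrow> nat set"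
  assumes N: "finite_disjoint_family N"
begin

lemma finite_block [simp]: "finite (N k)" and block_nonempty [simp]: "N k \<noteq> {}"
  using N by (auto simp: finite_disjoint_family_def)

lemma Min_block [simp]: "Min (N k) \<in> N k"
  by (rule Min_in) simp_all

lemma block_unique: "j \<in> N k \<Longrightarrow> j \<in> N l \<Longrightarrow> k = l"
  using N by (auto simp: finite_disjoint_family_def disjoint_family_on_def)

lemma block_spread_apply: "j \<in> N k \<Longrightarrow> block_spread N \<xi> j = \<xi> k"
proof -
  assume j: "j \<in> N k"
  then have "(THE k. j \<in> N k) = k"
    by (intro the_equality) (auto dest: block_unique)
  then show ?thesis using j by (auto simp: block_spread_def)
qed

lemma block_constant_spread: "block_constant N (block_spread N \<xi>)"
  unfolding block_constant_def by (auto simp: block_spread_apply) (auto simp: block_spread_def)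

lemma block_coeff_spread: "block_coeff N (block_spread N \<xi>) = \<xi>"
  by (simp add: block_coeff_def block_spread_apply[OF Min_block])

lemma block_coeff_apply: "block_constant N x \<Longrightarrow> j \<in> N k \<Longrightarrow> x j = block_coeff N x k"
  using Min_block unfolding block_constant_def block_coeff_def by blast

lemma block_constant_outside: "block_constant N x \<Longrightarrow> j \<notin> (\<Union>k. N k) \<Longrightarrow> x j = 0"
  unfolding block_constant_def by blast

lemma block_spread_coeff:
  assumes "block_constant N x"
  shows "block_spread N (block_coeff N x) = x"
proof
  fix j
  show "block_spread N (block_coeff N x) j = x j"
    using block_coeff_apply[OF assms] block_constant_outside[OF assms, of j]
    by (cases "j \<in> (\<Union>k. N k)") (auto simp: block_spread_apply, simp add: block_spread_def)
qed

lemma block_constant_e_set: "block_constant N (e_set (N k))"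
  unfolding block_constant_def by (auto simp: indicator_def dest: block_unique)

lemma block_constant_arith:
  assumes x: "block_constant N x"
  shows "block_constant N y \<Longrightarrow> block_constant N (x + y)"
    and "block_constant N y \<Longrightarrow> block_constant N (x * y)"
    and "block_constant N (cscale c x)" and "block_constant N (cconj x)"
  using x unfolding block_constant_def plus_fun_apply times_fun_apply cscale_apply cconj_apply
  by (metis add.right_neutral, metis mult_zero_left, metis mult_zero_right, metis complex_cnj_zero)

lemma block_sum_apply:
  assumes "j \<in> N k"
  shows "(\<Sum>i<n. cscale (c i) (e_set (N i))) j = (if k < n then c k else 0)"
proof -
  have "(\<Sum>i<n. cscale (c i) (e_set (N i))) j = (\<Sum>i<n. if i = k then c k else 0)"
    unfolding sum_apply using assms
    by (intro sum.cong) (auto simp: indicator_def dest: block_unique)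
  then show ?thesis by simp
qed

lemma block_sum_outside:
  "j \<notin> (\<Union>k. N k) \<Longrightarrow> (\<Sum>i<n. cscale (c i) (e_set (N i))) j = 0"
  unfolding sum_apply by (intro sum.neutral) auto

lemma block_space_e_set:
  assumes kothe: "kothe_matrix a"
  shows "e_set (N k) \<in> block_space a N"
  using kothe_space_finite_support[OF kothe, of "N k" "e_set (N k)"]
  by (simp add: block_space_def block_constant_e_set)

text \<open>
  Being constant on blocks is a family of equations between continuous coordinate functionals, and
  each of these equations is stable under the algebra operations.
\<close>

lemma closed_star_subalgebra_block_space:
  assumes kothe: "kothe_matrix a" and null: "kothe_space a \<subseteq> null_sequences"
  shows "closed_star_subalgebra (kothe_topology a) (block_space a N)"
proof -
  let ?V = "kothe_space a"
  have coord: "continuous_map (kothe_topology a) euclidean (\<lambda>x. x j)" for j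
    using continuous_map_kothe_coordinate[OF kothe order.refl, of j]
      subtopology_topspace[of "kothe_topology a"] by simp
  have eq: "closedin (kothe_topology a) {x \<in> ?V. x i = x j}" for i j
    using closedin_continuous_maps_eq[OF _ coord coord, of i j] by simp
  have zero: "closedin (kothe_topology a) {x \<in> ?V. x j = 0}" for j
    using closedin_continuous_maps_eq[OF _ coord, of "\<lambda>_. 0" j] by simp
  define A where "A = {(i, j). \<exists>k. i \<in> N k \<and> j \<in> N k}"
  define Z where "Z = - (\<Union>k. N k)"
  have "block_space a N = ?V \<inter> (\<Inter>(i, j)\<in>A. {x \<in> ?V. x i = x j}) \<inter> (\<Inter>j\<in>Z. {x \<in> ?V. x j = 0})"
    unfolding block_space_def block_constant_def A_def Z_def by blast
  also have "\<dots> = \<Inter>(insert ?V ((\<lambda>(i, j). {x \<in> ?V. x i = x j}) ` A \<union> (\<lambda>j. {x \<in> ?V. x j = 0}) ` Z))"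
    by blast
  also have "closedin (kothe_topology a) \<dots>"
    using eq zero closedin_topspace[of "kothe_topology a"]
    by (intro closedin_Inter) (auto split: prod.split)
  finally have "closedin (kothe_topology a) (block_space a N)" .
  moreover have "cseq.subspace (block_space a N)"
  proof (rule cseq.subspaceI)
    show "0 \<in> block_space a N"
      by (simp add: block_space_def block_constant_def kothe_space_zero[OF kothe])
    show "x + y \<in> block_space a N" if "x \<in> block_space a N" "y \<in> block_space a N" for x y
      using that kothe_space_add[OF kothe, of x y] block_constant_arith(1)
      by (simp add: block_space_def)
    show "cscale c x \<in> block_space a N" if "x \<in> block_space a N" for c x
      using that kothe_space_scale[OF kothe, of x c] block_constant_arith(3)
      by (simp add: block_space_def)
  qed
  moreover have "x * y \<in> block_space a N" if "x \<in> block_space a N" "y \<in> block_space a N" for x y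
    using that kothe_space_mult[OF assms, of x y] block_constant_arith(2)
    by (simp add: block_space_def)
  moreover have "cconj x \<in> block_space a N" if "x \<in> block_space a N" for x
    using that kothe_dominated(1)[OF kothe, of x "cconj x" 1] block_constant_arith(4)
    by (simp add: block_space_def)
  ultimately show ?thesis
    unfolding closed_star_subalgebra_def by simp
qed

text \<open>
  The \<open>n\<close>-th error is dominated coordinatewise by \<open>x\<close> and vanishes at each fixed coordinate once
  \<open>n\<close> is large. So the finitely many \<open>j\<close> with \<open>e * a j s < a j q\<close> eventually contribute nothing to
  its \<open>q\<close>-th seminorm, and the others contribute at most \<open>e\<close> times the \<open>s\<close>-th seminorm of \<open>x\<close>.
\<close>

lemma limitin_block_sums:
  assumes kothe: "kothe_matrix a"
    and ratio: "\<And>q. \<exists>s. \<forall>e>0. finite {j. e * a j s < a j q}"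
    and x: "x \<in> block_space a N"
  shows "limitin (kothe_topology a) (\<lambda>n. \<Sum>k<n. cscale (block_coeff N x k) (e_set (N k))) x sequentially"
    (is "limitin _ ?S _ _")
proof (rule limitin_kothe_topology[OF kothe])
  have bc: "block_constant N x" and xV: "x \<in> kothe_space a"
    using x by (auto simp: block_space_def)
  show "x \<in> kothe_space a" by (rule xV)
  show "?S n \<in> kothe_space a" for n
    using block_space_e_set[OF kothe]
    by (intro kothe_space_sum[OF kothe] kothe_space_scale[OF kothe]) (auto simp: block_space_def)
  have dom: "norm ((?S n - x) j) \<le> norm (x j)" for n j
  proof (cases "j \<in> (\<Union>k. N k)")
    case True
    then obtain k where k: "j \<in> N k" by blast
    show ?thesis
      by (simp only: minus_apply block_sum_apply[OF k] block_coeff_apply[OF bc k]) simp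
  next
    case False
    then show ?thesis
      by (simp only: minus_apply block_sum_outside) simp
  qed
  have ev: "\<forall>\<^sub>F n in sequentially. (?S n - x) j = 0" for j
  proof (cases "j \<in> (\<Union>k. N k)")
    case True
    then obtain k where k: "j \<in> N k" by blast
    show ?thesis
    proof (rule eventually_sequentiallyI[of "Suc k"])
      show "(?S n - x) j = 0" if "Suc k \<le> n" for n
        using that by (simp only: minus_apply block_sum_apply[OF k] block_coeff_apply[OF bc k]) simp
    qed
  next
    case False
    then show ?thesis
      by (simp only: minus_apply block_sum_outside) (simp add: block_constant_outside[OF bc])
  qed
  fix q
  obtain s where s: "\<And>e. e > 0 \<Longrightarrow> finite {j. e * a j s < a j q}"
    using ratio[of q] by blast
  show "(\<lambda>n. kothe_seminorm a q (?S n - x)) \<longlonglongrightarrow> 0"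
  proof (rule tendstoI)
    fix e :: real assume e: "e > 0"
    let ?D = "kothe_seminorm a s x"
    define e' where "e' = e / (?D + 1)"
    have D: "0 \<le> ?D" by (rule kothe_seminorm_nonneg[OF kothe xV])
    then have e': "e' > 0" "e' * ?D < e"
      using e by (simp_all add: e'_def field_simps)
    have "\<forall>\<^sub>F n in sequentially. \<forall>j\<in>{j. e' * a j s < a j q}. (?S n - x) j = 0"
      using s[OF e'(1)] ev by (intro eventually_ball_finite) auto
    then show "\<forall>\<^sub>F n in sequentially. dist (kothe_seminorm a q (?S n - x)) 0 < e"
    proof eventually_elim
      fix n assume n: "\<forall>j\<in>{j. e' * a j s < a j q}. (?S n - x) j = 0"
      have "norm ((?S n - x) j) * a j q \<le> e' * ?D" for j
      proof (cases "e' * a j s < a j q")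
        case True
        then have "(?S n - x) j = 0" using n by blast
        then show ?thesis using e' D by simp
      next
        case False
        then have "norm ((?S n - x) j) * a j q \<le> norm (x j) * (e' * a j s)"
          using dom[of n j] kothe_matrix_nonneg[OF kothe, of j q] by (intro mult_mono) auto
        also have "\<dots> = e' * (norm (x j) * a j s)" by simp
        also have "\<dots> \<le> e' * ?D"
          using e' by (intro mult_left_mono kothe_seminorm_upper[OF kothe xV]) auto
        finally show ?thesis .
      qed
      then have "kothe_seminorm a q (?S n - x) \<le> e' * ?D"
        by (rule kothe_seminorm_least[OF kothe])
      moreover have "0 \<le> kothe_seminorm a q (?S n - x)"
        by (intro kothe_seminorm_nonneg[OF kothe] kothe_space_diff[OF kothe] xV \<open>\<And>n. ?S n \<in> kothe_space a\<close>)
      ultimately show "dist (kothe_seminorm a q (?S n - x)) 0 < e"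
        using e' by (simp add: dist_real_def)
    qed
  qed
qed

text \<open>
  Coordinate functionals are continuous and a partial sum is eventually constant in \<open>n\<close> at each
  coordinate, so the coefficients of an expansion can be read off from the sequence itself.
\<close>

lemma schauder_basis_block_space:
  assumes kothe: "kothe_matrix a"
    and ratio: "\<And>q. \<exists>s. \<forall>e>0. finite {j. e * a j s < a j q}"
  shows "schauder_basis (subtopology (kothe_topology a) (block_space a N)) (\<lambda>k. e_set (N k))"
proof -
  let ?B = "block_space a N" and ?b = "\<lambda>k. e_set (N k)"
  let ?T = "subtopology (kothe_topology a) ?B"
  have BV: "?B \<subseteq> kothe_space a" by (auto simp: block_space_def)
  have top: "topspace ?T = ?B" using BV by auto
  have bc: "block_constant N (\<Sum>k<n. cscale (c k) (?b k))" for c n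
    unfolding block_constant_def by (simp add: block_sum_apply block_sum_outside del: sum_apply UN_iff)
  have sum_in: "(\<Sum>k<n. cscale (c k) (?b k)) \<in> ?B" for c n
    using bc block_space_e_set[OF kothe] unfolding block_space_def
    by (auto intro!: kothe_space_sum[OF kothe] kothe_space_scale[OF kothe] simp del: sum_apply)
  have ex: "expansion ?T ?b x (block_coeff N x)" if "x \<in> ?B" for x
    unfolding expansion_def limitin_subtopology
    using limitin_block_sums[OF assms that] that sum_in by simp
  have unique: "c = block_coeff N x" if c: "expansion ?T ?b x c" for x c
  proof
    fix k
    have "limitin (kothe_topology a) (\<lambda>n. \<Sum>k<n. cscale (c k) (?b k)) x sequentially"
      using c by (simp add: expansion_def limitin_subtopology)
    from limitin_kothe_coordinate[OF kothe this, of "Min (N k)"]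
    have "(\<lambda>n. if k < n then c k else 0) \<longlonglongrightarrow> x (Min (N k))"
      by (simp only: block_sum_apply[OF Min_block])
    moreover have "(\<lambda>n. if k < n then c k else 0) \<longlonglongrightarrow> c k"
      by (rule tendsto_eventually, rule eventually_sequentiallyI[of "Suc k"]) simp
    ultimately show "c k = block_coeff N x k"
      unfolding block_coeff_def using LIMSEQ_unique by blast
  qed
  have the: "(THE c. expansion ?T ?b x c) = block_coeff N x" if "x \<in> ?B" for x
    using ex[OF that] unique by blast
  have "continuous_map ?T euclidean (\<lambda>x. (THE c. expansion ?T ?b x c) k)" for k
  proof (rule continuous_map_eq[OF continuous_map_kothe_coordinate[OF kothe BV, of "Min (N k)"]])
    show "x (Min (N k)) = (THE c. expansion ?T ?b x c) k" if "x \<in> topspace ?T" for x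
      using the[of x] that top by (simp add: block_coeff_def)
  qed
  then show ?thesis
    unfolding schauder_basis_def top using block_space_e_set[OF kothe] ex unique by blast
qed

lemma kothe_matrix_block_max:
  assumes kothe: "kothe_matrix a"
  shows "kothe_matrix (block_max a N)"
proof -
  have "0 \<le> block_max a N k q" for k q
    using kothe_matrix_nonneg[OF kothe, of "Min (N k)" q]
    unfolding block_max_def by (subst Max_ge_iff) (auto intro!: bexI[of _ "Min (N k)"])
  moreover have "\<exists>q. 0 < block_max a N k q" for k
  proof -
    obtain q where "0 < a (Min (N k)) q" using kothe_matrix_pos[OF kothe] by blast
    also have "a (Min (N k)) q \<le> block_max a N k q"
      unfolding block_max_def by (intro Max_ge) auto
    finally show ?thesis by blast
  qed
  moreover have "block_max a N k q \<le> block_max a N k (Suc q)" for k q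
    unfolding block_max_def
  proof (rule Max.boundedI)
    fix u assume "u \<in> (\<lambda>j. a j q) ` N k"
    then obtain j where j: "j \<in> N k" "u = a j q" by blast
    then have "u \<le> a j (Suc q)" using kothe_matrix_mono[OF kothe, of q "Suc q" j] by simp
    also have "\<dots> \<le> (MAX j\<in>N k. a j (Suc q))" using j by (intro Max_ge) auto
    finally show "u \<le> (MAX j\<in>N k. a j (Suc q))" .
  qed auto
  ultimately show ?thesis
    unfolding kothe_matrix_def by blast
qed

text \<open>
  The supremum over the indices of a block of a constant times \<open>a j q\<close> is that constant times the
  block maximum. This one equivalence makes \<open>block_coeff N\<close> preserve membership and all seminorms.
\<close>

lemma block_bound_iff:
  assumes x: "block_constant N x" and B: "0 \<le> B"
  shows "(\<forall>j. norm (x j) * a j q \<le> B) \<longleftrightarrow> (\<forall>k. norm (block_coeff N x k) * block_max a N k q \<le> B)"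
proof (intro iffI allI)
  fix k assume L: "\<forall>j. norm (x j) * a j q \<le> B"
  have "block_max a N k q \<in> (\<lambda>j. a j q) ` N k"
    unfolding block_max_def by (rule Max_in) auto
  then obtain j where "j \<in> N k" "block_max a N k q = a j q" by blast
  then show "norm (block_coeff N x k) * block_max a N k q \<le> B"
    using L block_coeff_apply[OF x, of j k] by metis
next
  fix j assume R: "\<forall>k. norm (block_coeff N x k) * block_max a N k q \<le> B"
  show "norm (x j) * a j q \<le> B"
  proof (cases "j \<in> (\<Union>k. N k)")
    case True
    then obtain k where k: "j \<in> N k" by blast
    then have "a j q \<le> block_max a N k q"
      unfolding block_max_def by (intro Max_ge) auto
    then have "norm (x j) * a j q \<le> norm (block_coeff N x k) * block_max a N k q"
      unfolding block_coeff_apply[OF x k] by (rule mult_left_mono) simp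
    then show ?thesis using R order.trans by blast
  next
    case False
    then show ?thesis using block_constant_outside[OF x] B by simp
  qed
qed

lemma block_coeff_in_kothe_space_iff:
  assumes x: "block_constant N x"
  shows "block_coeff N x \<in> kothe_space (block_max a N) \<longleftrightarrow> x \<in> kothe_space a"
proof -
  have iff: "z \<in> kothe_space b \<longleftrightarrow> (\<forall>q. \<exists>B\<ge>0. \<forall>j. norm (z j) * b j q \<le> B)" for z b
  proof
    assume "z \<in> kothe_space b"
    then have *: "\<exists>B. \<forall>j. norm (z j) * b j q \<le> B" for q
      by (auto simp: kothe_space_def bdd_above_def)
    show "\<forall>q. \<exists>B\<ge>0. \<forall>j. norm (z j) * b j q \<le> B"
    proof
      fix q
      obtain B where "\<forall>j. norm (z j) * b j q \<le> B" using * by blast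
      then show "\<exists>B\<ge>0. \<forall>j. norm (z j) * b j q \<le> B"
        by (intro exI[of _ "max 0 B"]) (auto simp: le_max_iff_disj)
    qed
  qed (auto simp: kothe_space_def bdd_above_def)
  show ?thesis
    unfolding iff by (simp add: block_bound_iff[OF x] cong: conj_cong)
qed

lemma kothe_seminorm_block_coeff:
  assumes kothe: "kothe_matrix a" and x: "x \<in> block_space a N"
  shows "kothe_seminorm (block_max a N) q (block_coeff N x) = kothe_seminorm a q x"
proof -
  have xV: "x \<in> kothe_space a" and bc: "block_constant N x"
    using x by (auto simp: block_space_def)
  have xV': "block_coeff N x \<in> kothe_space (block_max a N)"
    using xV by (simp add: block_coeff_in_kothe_space_iff[OF bc])
  note kothe' = kothe_matrix_block_max[OF kothe]
  show ?thesis
  proof (rule antisym)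
    show "kothe_seminorm (block_max a N) q (block_coeff N x) \<le> kothe_seminorm a q x"
      using block_bound_iff[OF bc kothe_seminorm_nonneg[OF kothe xV, of q], of a q]
        kothe_seminorm_upper[OF kothe xV] by (intro kothe_seminorm_least[OF kothe']) blast
    show "kothe_seminorm a q x \<le> kothe_seminorm (block_max a N) q (block_coeff N x)"
      using block_bound_iff[OF bc kothe_seminorm_nonneg[OF kothe' xV', of q], of a q]
        kothe_seminorm_upper[OF kothe' xV'] by (intro kothe_seminorm_least[OF kothe]) blast
  qed
qed

lemma frechet_star_algebra_iso_block_coeff:
  assumes kothe: "kothe_matrix a" and null: "kothe_space a \<subseteq> null_sequences"
  shows "frechet_star_algebra_iso (subtopology (kothe_topology a) (block_space a N))
    (kothe_topology (block_max a N)) (block_coeff N)"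
proof -
  let ?B = "block_space a N" and ?m = "block_max a N"
  note kothe' = kothe_matrix_block_max[OF kothe]
  have BV: "?B \<subseteq> kothe_space a" by (auto simp: block_space_def)
  have top: "topspace (subtopology (kothe_topology a) ?B) = ?B" using BV by auto
  have sub: "cseq.subspace ?B"
    using closed_star_subalgebra_block_space[OF assms] by (simp add: closed_star_subalgebra_def)
  have diff: "block_coeff N (x - y) = block_coeff N x - block_coeff N y" for x y
    by (simp add: block_coeff_def fun_eq_iff)
  have coeff_in: "block_coeff N x \<in> kothe_space ?m" if "x \<in> ?B" for x
    using that block_coeff_in_kothe_space_iff by (simp add: block_space_def)
  have spread_in: "block_spread N \<xi> \<in> ?B" if "\<xi> \<in> kothe_space ?m" for \<xi>
    using that block_coeff_in_kothe_space_iff[OF block_constant_spread[of \<xi>], of a]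
    by (simp add: block_space_def block_constant_spread block_coeff_spread)
  have isometry: "kothe_seminorm ?m q (block_coeff N y - block_coeff N x) = kothe_seminorm a q (y - x)"
    if "x \<in> ?B" "y \<in> ?B" for x y q
    using kothe_seminorm_block_coeff[OF kothe cseq.subspace_diff[OF sub that(2,1)]] by (simp add: diff)
  have "continuous_map (subtopology (kothe_topology a) ?B) (kothe_topology ?m) (block_coeff N)"
  proof (rule continuous_map_kothe_topologyI[OF kothe BV])
    fix x U assume x: "x \<in> ?B" and "openin (kothe_topology ?m) U" "block_coeff N x \<in> U"
    then obtain q r where "r > 0"
      "{\<eta> \<in> kothe_space ?m. kothe_seminorm ?m q (\<eta> - block_coeff N x) < r} \<subseteq> U"
      unfolding openin_kothe_topology[OF kothe'] by blast
    then show "\<exists>q. \<exists>r>0. \<forall>y\<in>?B. kothe_seminorm a q (y - x) < r \<longrightarrow> block_coeff N y \<in> U"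
      using isometry[OF x] coeff_in by (intro exI[of _ q] exI[of _ r]) auto
  qed (simp add: coeff_in)
  moreover have "continuous_map (kothe_topology ?m) (subtopology (kothe_topology a) ?B) (block_spread N)"
  proof (rule continuous_map_into_subtopology)
    have "continuous_map (subtopology (kothe_topology ?m) (kothe_space ?m)) (kothe_topology a) (block_spread N)"
    proof (rule continuous_map_kothe_topologyI[OF kothe' order.refl])
      fix \<xi> U assume \<xi>: "\<xi> \<in> kothe_space ?m"
        and "openin (kothe_topology a) U" "block_spread N \<xi> \<in> U"
      then obtain q r where r: "r > 0"
        "{y \<in> kothe_space a. kothe_seminorm a q (y - block_spread N \<xi>) < r} \<subseteq> U"
        unfolding openin_kothe_topology[OF kothe] by blast
      have "block_spread N \<eta> \<in> U"
        if "\<eta> \<in> kothe_space ?m" "kothe_seminorm ?m q (\<eta> - \<xi>) < r" for \<eta>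
        using isometry[OF spread_in[OF \<xi>] spread_in[OF that(1)], of q] that(2) r(2)
          spread_in[OF that(1)] BV by (auto simp: block_coeff_spread)
      then show "\<exists>q. \<exists>r>0. \<forall>\<eta>\<in>kothe_space ?m.
          kothe_seminorm ?m q (\<eta> - \<xi>) < r \<longrightarrow> block_spread N \<eta> \<in> U"
        using r(1) by blast
    qed (use spread_in BV in auto)
    then show "continuous_map (kothe_topology ?m) (kothe_topology a) (block_spread N)"
      using subtopology_topspace[of "kothe_topology ?m"] by simp
  qed (simp add: spread_in)
  ultimately have "homeomorphic_maps (subtopology (kothe_topology a) ?B) (kothe_topology ?m)
      (block_coeff N) (block_spread N)"
    unfolding homeomorphic_maps_def top topspace_kothe_topology
    by (simp add: block_coeff_spread block_spread_coeff block_space_def)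
  then show ?thesis
    unfolding frechet_star_algebra_iso_def
    by (auto simp: homeomorphic_map_maps block_coeff_def fun_eq_iff)
qed

lemma block_coeff_e_set: "block_coeff N (e_set (N k)) = e_set {k}"
proof
  fix l
  have "Min (N l) \<in> N k \<longleftrightarrow> l = k"
    using block_unique[OF Min_block] by auto
  then show "block_coeff N (e_set (N k)) l = e_set {k} l"
    by (simp add: block_coeff_def indicator_def)
qed

text \<open>
  The partial sums of a block expansion lie in \<open>E\<close>, hence so does their limit.
\<close>

lemma block_space_subset:
  assumes kothe: "kothe_matrix a"
    and ratio: "\<And>q. \<exists>s. \<forall>e>0. finite {j. e * a j s < a j q}"
    and E: "closed_star_subalgebra (kothe_topology a) E" "\<And>k. e_set (N k) \<in> E"
  shows "block_space a N \<subseteq> E"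
proof
  fix x assume x: "x \<in> block_space a N"
  show "x \<in> E"
  proof (rule limitin_closedin[OF limitin_block_sums[OF kothe ratio x]])
    show "closedin (kothe_topology a) E"
      using E by (simp add: closed_star_subalgebra_def)
    have "(\<Sum>k<n. cscale (block_coeff N x k) (e_set (N k))) \<in> E" for n
      using E unfolding closed_star_subalgebra_def
      by (intro cseq.subspace_sum cseq.subspace_scale) auto
    then show "\<forall>\<^sub>F n in sequentially. (\<Sum>k<n. cscale (block_coeff N x k) (e_set (N k))) \<in> E"
      by simp
  qed simp
qed

lemma hull_eq_block_space:
  assumes kothe: "kothe_matrix a" and null: "kothe_space a \<subseteq> null_sequences"
    and ratio: "\<And>q. \<exists>s. \<forall>e>0. finite {j. e * a j s < a j q}"
  shows "closed_star_subalgebra (kothe_topology a) hull range (\<lambda>k. e_set (N k)) = block_space a N"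
proof (rule hull_unique)
  show "range (\<lambda>k. e_set (N k)) \<subseteq> block_space a N"
    using block_space_e_set[OF kothe] by blast
  show "closed_star_subalgebra (kothe_topology a) (block_space a N)"
    by (rule closed_star_subalgebra_block_space[OF kothe null])
  show "block_space a N \<subseteq> E"
    if "range (\<lambda>k. e_set (N k)) \<subseteq> E" "closed_star_subalgebra (kothe_topology a) E" for E
    using that by (intro block_space_subset[OF kothe ratio]) auto
qed

end

section \<open>Idempotents in closed subalgebras\<close>

lemma subalgebra_power:
  assumes E: "closed_star_subalgebra T E" and x: "x \<in> E"
  shows "(\<lambda>j. x j ^ Suc n) \<in> E"
proof (induction n)
  case 0
  then show ?case using x by simp
next
  case (Suc n)
  have "(\<lambda>j. x j ^ Suc (Suc n)) = x * (\<lambda>j. x j ^ Suc n)"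
    by (simp add: fun_eq_iff)
  then show ?case
    using E x Suc unfolding closed_star_subalgebra_def by simp
qed

lemma subalgebra_mult_roots:
  assumes E: "closed_star_subalgebra T E" and x: "x \<in> E" and w: "w \<in> E" and D: "finite D"
  shows "(\<lambda>j. w j * (\<Prod>d\<in>D. x j - d)) \<in> E"
  using D
proof (induction D)
  case empty
  then show ?case using w by simp
next
  case (insert d D)
  let ?u = "\<lambda>j. w j * (\<Prod>d\<in>D. x j - d)"
  have "(\<lambda>j. w j * (\<Prod>d\<in>insert d D. x j - d)) = ?u * x - cscale d ?u"
    using insert by (simp add: fun_eq_iff algebra_simps)
  moreover have "?u * x - cscale d ?u \<in> E"
    using E insert x unfolding closed_star_subalgebra_def
    by (intro cseq.subspace_diff cseq.subspace_scale) auto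
  ultimately show ?case by simp
qed

text \<open>
  Away from the finite set where \<open>x\<close> has modulus at least 1/2, powers of \<open>x\<close> decay
  geometrically. Multiplying them by a fixed polynomial in \<open>x\<close> that is 1 at the value 1 and vanishes
  at the other values on that finite set yields elements of \<open>E\<close> that converge to the indicator of
  the level set.
\<close>

lemma level_set_one_mem:
  assumes kothe: "kothe_matrix a" and null: "kothe_space a \<subseteq> null_sequences"
    and E: "closed_star_subalgebra (kothe_topology a) E" and x: "x \<in> E"
  shows "finite {j. x j = 1}" "e_set {j. x j = 1} \<in> E"
proof -
  have EV: "E \<subseteq> kothe_space a"
    using E closedin_subset[of "kothe_topology a" E] by (simp add: closed_star_subalgebra_def)
  have lim: "x \<longlonglongrightarrow> 0"
    using null x EV by (auto simp: null_sequences_def)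
  define S where "S = {j. 1 / 2 \<le> norm (x j)}"
  have "\<forall>\<^sub>F j in sequentially. norm (x j) < 1 / 2"
    using order_tendstoD(2)[OF tendsto_norm_zero[OF lim], of "1 / 2"] by simp
  then obtain m where "\<And>j. m \<le> j \<Longrightarrow> norm (x j) < 1 / 2"
    unfolding eventually_sequentially by blast
  then have "S \<subseteq> {..<m}"
    unfolding S_def by (metis (mono_tags) lessThan_iff mem_Collect_eq not_le subsetI)
  then have S: "finite S" by (rule finite_subset) simp
  have one_S: "{j. x j = 1} \<subseteq> S" by (auto simp: S_def)
  then show "finite {j. x j = 1}" using S by (rule finite_subset)
  have "Bseq x"
    using lim by (intro convergent_imp_Bseq convergentI)
  then obtain B where B: "\<And>j. norm (x j) \<le> B"
    unfolding Bseq_def by blast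
  define D where "D = x ` S - {1}"
  have D: "finite D" using S by (simp add: D_def)
  define P where "P = (\<Prod>d\<in>D. 1 - d)"
  have P: "P \<noteq> 0" using D by (auto simp: P_def D_def)
  define z where "z n = cscale (inverse P) (\<lambda>j. x j ^ Suc n * (\<Prod>d\<in>D. x j - d))" for n
  define M where "M = norm (inverse P) * (\<Prod>d\<in>D. B + norm d)"
  have bound: "norm (inverse P) * norm (\<Prod>d\<in>D. x j - d) \<le> M" for j
    unfolding M_def prod_norm[symmetric]
  proof (intro mult_left_mono prod_mono conjI)
    show "norm (x j - d) \<le> B + norm d" for d
      using norm_triangle_ineq4[of "x j" d] B[of j] by linarith
  qed auto
  have dom: "norm ((z n - e_set {j. x j = 1}) j) \<le> M * (1 / 2) ^ n * norm (x j)" for n j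
  proof -
    have M0: "0 \<le> M" using order.trans[OF _ bound] by simp
    \<comment> \<open>Equality with the indicator holds on \<open>S\<close>: at the value 1 by normalisation, elsewhere by a root.\<close>
    consider "x j = 1" | "j \<in> S" "x j \<noteq> 1" | "j \<notin> S" by blast
    then show ?thesis
    proof cases
      case 1
      then have "z n j = 1" using P by (simp add: z_def P_def)
      then show ?thesis using 1 M0 by simp
    next
      case 2
      then have "(\<Prod>d\<in>D. x j - d) = 0"
        using D by (intro prod_zero) (auto simp: D_def)
      then have "z n j = 0" by (simp add: z_def)
      then show ?thesis using 2 M0 by simp
    next
      case 3
      then have j: "norm (x j) \<le> 1 / 2" "x j \<noteq> 1" using one_S by (auto simp: S_def)
      have "norm (z n j) = (norm (inverse P) * norm (\<Prod>d\<in>D. x j - d)) * norm (x j) ^ n * norm (x j)"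
        by (simp add: z_def norm_mult norm_power)
      also have "\<dots> \<le> M * (1 / 2) ^ n * norm (x j)"
        by (intro mult_right_mono mult_mono bound power_mono j M0) auto
      finally show ?thesis using j by simp
    qed
  qed
  have z_E: "z n \<in> E" for n
    unfolding z_def
    using subalgebra_mult_roots[OF E x subalgebra_power[OF E x] D] E
    unfolding closed_star_subalgebra_def by (intro cseq.subspace_scale) auto
  have e_V: "e_set {j. x j = 1} \<in> kothe_space a"
    by (rule kothe_space_finite_support[OF kothe \<open>finite {j. x j = 1}\<close>]) simp
  have "limitin (kothe_topology a) z (e_set {j. x j = 1}) sequentially"
  proof (rule limitin_kothe_topology[OF kothe e_V])
    show "z n \<in> kothe_space a" for n using z_E EV by blast
    fix q
    show "(\<lambda>n. kothe_seminorm a q (z n - e_set {j. x j = 1})) \<longlonglongrightarrow> 0"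
    proof (rule tendsto_sandwich[OF _ _ tendsto_const])
      have xV: "x \<in> kothe_space a" using x EV by blast
      show "\<forall>\<^sub>F n in sequentially. 0 \<le> kothe_seminorm a q (z n - e_set {j. x j = 1})"
        by (intro always_eventually allI kothe_seminorm_nonneg[OF kothe] kothe_dominated(1)[OF kothe xV dom])
      show "\<forall>\<^sub>F n in sequentially. kothe_seminorm a q (z n - e_set {j. x j = 1})
          \<le> M * (1 / 2) ^ n * kothe_seminorm a q x"
        by (intro always_eventually allI kothe_dominated(2)[OF kothe xV dom])
      show "(\<lambda>n. M * (1 / 2) ^ n * kothe_seminorm a q x) \<longlonglongrightarrow> 0"
        by (intro tendsto_mult_left_zero tendsto_mult_right_zero LIMSEQ_power_zero) simp
    qed
  qed
  then show "e_set {j. x j = 1} \<in> E"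
    by (rule limitin_closedin) (use E z_E in \<open>auto simp: closed_star_subalgebra_def\<close>)
qed

lemma level_set_mem:
  assumes kothe: "kothe_matrix a" and null: "kothe_space a \<subseteq> null_sequences"
    and E: "closed_star_subalgebra (kothe_topology a) E" and x: "x \<in> E" and c: "c \<noteq> 0"
  shows "finite {j. x j = c}" "e_set {j. x j = c} \<in> E"
proof -
  have "cscale (inverse c) x \<in> E"
    using E x by (auto simp: closed_star_subalgebra_def intro: cseq.subspace_scale)
  moreover have "{j. cscale (inverse c) x j = 1} = {j. x j = c}"
    using c by (auto simp: field_simps)
  ultimately show "finite {j. x j = c}" "e_set {j. x j = c} \<in> E"
    using level_set_one_mem[OF kothe null E, of "cscale (inverse c) x"] by simp_all
qed

text \<open>
  The class of \<open>j\<close> for the equivalence relation of not being separated by \<open>E\<close>.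
\<close>

definition fibre :: "cseq set \<Rightarrow> nat \<Rightarrow> nat set"
  where "fibre E j = {i. \<forall>x\<in>E. x i = x j}"

text \<open>
  Among the finite sets that contain \<open>j\<close> and have their indicator in \<open>E\<close>, one of least size
  must be the fibre: if some \<open>x \<in> E\<close> separated two of its points, cutting it with a level set of
  \<open>x\<close>, or with the complement of one, would produce a smaller such set.
\<close>

lemma fibre_mem:
  assumes kothe: "kothe_matrix a" and null: "kothe_space a \<subseteq> null_sequences"
    and E: "closed_star_subalgebra (kothe_topology a) E" and x0: "x0 \<in> E" "x0 j \<noteq> 0"
  shows "finite (fibre E j)" "e_set (fibre E j) \<in> E"
proof -
  note level = level_set_mem[OF kothe null E]
  have sub: "cseq.subspace E" and mult: "\<And>x y. x \<in> E \<Longrightarrow> y \<in> E \<Longrightarrow> x * y \<in> E"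
    using E by (auto simp: closed_star_subalgebra_def)
  let ?F = "\<lambda>M. finite M \<and> j \<in> M \<and> e_set M \<in> E"
  have "?F {i. x0 i = x0 j}" using level[OF x0] by simp
  then obtain M where M: "?F M" and least: "\<And>M'. ?F M' \<Longrightarrow> card M \<le> card M'"
    using ex_has_least_nat[of ?F _ card] by blast
  have no_smaller: "i \<in> M'" if "i \<in> M" "M' \<subseteq> M" "j \<in> M'" "e_set M' \<in> E" for i M'
    using least[of M'] M that by (metis card_seteq finite_subset)
  have const: "x i = x j" if x: "x \<in> E" and i: "i \<in> M" for x i
  proof (rule ccontr)
    assume ne: "x i \<noteq> x j"
    show False
    proof (cases "x j = 0")
      case False
      have "e_set M * e_set {l. x l = x j} = e_set (M \<inter> {l. x l = x j})"
        by (auto simp: fun_eq_iff indicator_def)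
      then have "e_set (M \<inter> {l. x l = x j}) \<in> E"
        using mult[OF _ level(2)[OF x False], of "e_set M"] M by simp
      then show False using no_smaller[OF i, of "M \<inter> {l. x l = x j}"] M ne by simp
    next
      case True
      then have nz: "x i \<noteq> 0" using ne by simp
      \<comment> \<open>Level sets of the value 0 need not be finite, so remove the level set of \<open>x i\<close> instead.\<close>
      have "e_set M - e_set M * e_set {l. x l = x i} = e_set (M - {l. x l = x i})"
        by (auto simp: fun_eq_iff indicator_def)
      moreover have "e_set M - e_set M * e_set {l. x l = x i} \<in> E"
        using M by (intro cseq.subspace_diff[OF sub] mult level(2)[OF x nz]) auto
      ultimately have "e_set (M - {l. x l = x i}) \<in> E" by simp
      then show False using no_smaller[OF i, of "M - {l. x l = x i}"] M ne by auto
    qed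
  qed
  have "fibre E j = M"
  proof
    show "M \<subseteq> fibre E j" using const by (auto simp: fibre_def)
    show "fibre E j \<subseteq> M"
    proof
      fix i assume "i \<in> fibre E j"
      then have "e_set M i = (e_set M j :: complex)" using M unfolding fibre_def by blast
      then show "i \<in> M" using M by (simp add: indicator_def split: if_splits)
    qed
  qed
  then show "finite (fibre E j)" "e_set (fibre E j) \<in> E" using M by auto
qed

text \<open>
  The blocks are the fibres of the points at which \<open>E\<close> does not vanish identically. If there were
  only finitely many, their indicators would span \<open>E\<close>.
\<close>

lemma closed_star_subalgebra_eq_block_space:
  assumes kothe: "kothe_matrix a" and null: "kothe_space a \<subseteq> null_sequences"
    and ratio: "\<And>q. \<exists>s. \<forall>e>0. finite {j. e * a j s < a j q}"
    and E: "closed_star_subalgebra (kothe_topology a) E" and inf: "infinite_dimensional E"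
  obtains N where "finite_disjoint_family N" "E = block_space a N"
proof -
  define supp where "supp = {j. \<exists>x\<in>E. x j \<noteq> 0}"
  define \<B> where "\<B> = fibre E ` supp"
  have fin: "finite M" and mem: "e_set M \<in> E" if "M \<in> \<B>" for M
    using that fibre_mem[OF kothe null E] by (auto simp: \<B>_def supp_def)
  have nonempty: "M \<noteq> {}" if "M \<in> \<B>" for M
    using that by (auto simp: \<B>_def fibre_def)
  have disj: "M = M'" if "M \<in> \<B>" "M' \<in> \<B>" "j \<in> M" "j \<in> M'" for M M' j
  proof -
    obtain i i' where ii: "M = fibre E i" "M' = fibre E i'"
      using \<open>M \<in> \<B>\<close> \<open>M' \<in> \<B>\<close> by (auto simp: \<B>_def)
    then have "\<forall>x\<in>E. x i = x i'"
      using \<open>j \<in> M\<close> \<open>j \<in> M'\<close> unfolding fibre_def by fastforce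
    then show ?thesis unfolding ii fibre_def by auto
  qed
  have cover: "x j = 0" if "j \<notin> \<Union>\<B>" "x \<in> E" for x j
    using that by (auto simp: \<B>_def fibre_def supp_def)
  have const: "x i = x j" if "x \<in> E" "M \<in> \<B>" "i \<in> M" "j \<in> M" for x i j M
    using that by (auto simp: \<B>_def fibre_def)
  have EV: "E \<subseteq> kothe_space a"
    using E closedin_subset[of "kothe_topology a" E] by (simp add: closed_star_subalgebra_def)
  have sub: "cseq.subspace E" using E by (simp add: closed_star_subalgebra_def)
  have "infinite \<B>"
  proof
    assume \<B>: "finite \<B>"
    have "x \<in> cseq.span (e_set ` \<B>)" if x: "x \<in> E" for x
    proof -
      have "x j = (\<Sum>M\<in>\<B>. cscale (x (Min M)) (e_set M)) j" for j
      proof (cases "j \<in> \<Union>\<B>")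
        case True
        then obtain M where M: "M \<in> \<B>" "j \<in> M" by blast
        have "(\<Sum>M'\<in>\<B>. cscale (x (Min M')) (e_set M')) j = (\<Sum>M'\<in>\<B>. if M' = M then x (Min M) else 0)"
          unfolding sum_apply
        proof (rule sum.cong[OF refl])
          fix M' assume "M' \<in> \<B>"
          then have "j \<in> M' \<longleftrightarrow> M' = M" using disj[OF _ M(1) _ M(2)] M(2) by blast
          then show "cscale (x (Min M')) (e_set M') j = (if M' = M then x (Min M) else 0)"
            by (simp add: indicator_def)
        qed
        also have "\<dots> = x j"
          using \<B> M(1) const[OF x M(1) Min_in[OF fin nonempty] M(2)] by simp
        finally show ?thesis by simp
      next
        case False
        then have "(\<Sum>M\<in>\<B>. cscale (x (Min M)) (e_set M)) j = 0"
          unfolding sum_apply by (intro sum.neutral) auto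
        then show ?thesis using cover[OF False x] by simp
      qed
      then have "x = (\<Sum>M\<in>\<B>. cscale (x (Min M)) (e_set M))" by blast
      also have "\<dots> \<in> cseq.span (e_set ` \<B>)"
        by (intro cseq.span_sum cseq.span_scale cseq.span_base) blast
      finally show ?thesis .
    qed
    moreover have "cseq.span (e_set ` \<B>) \<subseteq> E"
      using mem by (intro cseq.span_minimal sub) blast
    ultimately have "cseq.span (e_set ` \<B>) = E" by blast
    then show False using inf \<B> unfolding infinite_dimensional_def by blast
  qed
  moreover have "countable \<B>" by (simp add: \<B>_def)
  ultimately have bij: "bij_betw (from_nat_into \<B>) UNIV \<B>"
    by (intro bij_betw_from_nat_into)
  define N where "N = from_nat_into \<B>"
  have N: "N k \<in> \<B>" for k using bij bij_betwE by (fastforce simp: N_def)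
  have UN: "(\<Union>k. N k) = \<Union>\<B>" using bij by (simp add: N_def bij_betw_def)
  have fdf: "finite_disjoint_family N"
    unfolding finite_disjoint_family_def disjoint_family_on_def
  proof (intro conjI allI ballI impI)
    show "finite (N k)" "N k \<noteq> {}" for k using fin[OF N] nonempty[OF N] by auto
    show "N k \<inter> N l = {}" if "k \<noteq> l" for k l
    proof -
      have "N k \<noteq> N l" using bij that by (auto simp: N_def bij_betw_def inj_on_def)
      then show ?thesis using disj[OF N N] by blast
    qed
  qed
  moreover have "E = block_space a N"
  proof
    show "E \<subseteq> block_space a N"
      unfolding block_space_def block_constant_def UN using EV const N cover by blast
    show "block_space a N \<subseteq> E"
      using mem[OF N] by (intro block_space_subset[OF fdf kothe ratio E])
  qed
  ultimately show ?thesis using that by blast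
qed

section \<open>Closed star-subalgebras of nuclear Koethe algebras\<close>

theorem proposition4p3:
  fixes a :: "nat \<Rightarrow> nat \<Rightarrow> real"
  assumes "kothe_matrix a"
    and "nuclear_space (kothe_topology a)"
    and "kothe_space a \<subseteq> null_sequences"
  shows
    "(\<forall>E. closed_star_subalgebra (kothe_topology a) E \<and> infinite_dimensional E \<longrightarrow>
        (\<exists>N. finite_disjoint_family N \<and>
             schauder_basis (subtopology (kothe_topology a) E) (\<lambda>k. e_set (N k)) \<and>
             (\<exists>\<phi>. frechet_star_algebra_iso (subtopology (kothe_topology a) E)
                     (kothe_topology (block_max a N)) \<phi> \<and>
                   (\<forall>k. \<phi> (e_set (N k)) = e_set {k})))) \<and>
     (\<forall>N F. finite_disjoint_family N \<and>
        F = closed_star_subalgebra (kothe_topology a) hull range (\<lambda>k. e_set (N k)) \<longrightarrow>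
          schauder_basis (subtopology (kothe_topology a) F) (\<lambda>k. e_set (N k)) \<and>
          (\<exists>\<phi>. frechet_star_algebra_iso (subtopology (kothe_topology a) F)
                  (kothe_topology (block_max a N)) \<phi> \<and>
                (\<forall>k. \<phi> (e_set (N k)) = e_set {k})))"
proof -
  note kothe = assms(1) and null = assms(3)
  note ratio = finite_large_ratio_of_nuclear[OF assms(1,2)]
  have block: "schauder_basis (subtopology (kothe_topology a) (block_space a N)) (\<lambda>k. e_set (N k)) \<and>
      (\<exists>\<phi>. frechet_star_algebra_iso (subtopology (kothe_topology a) (block_space a N))
          (kothe_topology (block_max a N)) \<phi> \<and> (\<forall>k. \<phi> (e_set (N k)) = e_set {k}))"
    if N: "finite_disjoint_family N" for N
    using schauder_basis_block_space[OF N kothe ratio]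
      frechet_star_algebra_iso_block_coeff[OF N kothe null] block_coeff_e_set[OF N] by blast
  show ?thesis
  proof (intro conjI allI impI, goal_cases)
    case (1 E)
    then obtain N where "finite_disjoint_family N" "E = block_space a N"
      using closed_star_subalgebra_eq_block_space[OF kothe null ratio] by blast
    then show ?case using block by blast
  next
    case (2 N F)
    then have "F = block_space a N" using hull_eq_block_space[OF _ kothe null ratio] by simp
    then show ?case using block 2 by simp
  next
    case (3 N F)
    then have "F = block_space a N" using hull_eq_block_space[OF _ kothe null ratio] by simp
    then show ?case using block 3 by simp
  qed
qed

end
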